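(* If a state $W^0\in\widehat H^0(\mathbb R^2)$ is controllable to the state $W^T=0$ in a given time $T>0$, then $W^0=0$.
   Context: Function spaces are complex. $\widehat H^0(\mathbb R^2)$ is the subspace of $L^2(\mathbb R^2)$ of functions even with respect to $x_1$. For $W^0\in\widehat H^0(\mathbb R^2)$ and $u\in L^\infty(0,T)$ put $$\mathcal W_0(\cdot,T)=\frac1{4\pi T}e^{-\frac{|\cdot|^2}{4T}}*W^0,\qquad \mathcal W_u(x,T)=-\frac1\pi\int_0^T\frac1{2\xi}e^{-\frac{|x|^2}{4\xi}}u(T-\xi)\,d\xi .$$ Then $W(\cdot,T)=\mathcal W_0(\cdot,T)+\mathcal W_u(\cdot,T)$ is the state at time $T$ of the unique solution of the control system $W_t=\Delta W-2\delta u(t)$, $W(\cdot,0)=W^0$ on $\mathbb R^2$. $W^0$ is controllable to $W^T\in\widehat H^0(\mathbb R^2)$ in time $T$ if there exists $u\in L^\infty(0,T)$ such that $W^T=\mathcal W_0(\cdot,T)+\mathcal W_u(\cdot,T)$. *)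

theory Defs
  imports "HOL-Analysis.Analysis"
begin

text \<open>
  Elements of \<open>L\<^sup>2\<close> and \<open>L\<^sup>\<infinity>\<close> are represented by Lebesgue measurable functions, not by
  equivalence classes; accordingly equality of states and evenness are required almost everywhere.
\<close>

definition L2_plane :: "(real^2 \<Rightarrow> complex) set" where
  "L2_plane = {f. f \<in> borel_measurable lebesgue \<and> integrable lebesgue (\<lambda>x. (norm (f x))\<^sup>2)}"

definition even_x1 :: "(real^2 \<Rightarrow> complex) \<Rightarrow> bool" where
  "even_x1 f \<longleftrightarrow> (AE x in lebesgue. f (vector [- (x $ 1), x $ 2]) = f x)"

definition H0_hat :: "(real^2 \<Rightarrow> complex) set" where
  "H0_hat = {f \<in> L2_plane. even_x1 f}"

definition Linf :: "real \<Rightarrow> (real \<Rightarrow> complex) set" where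
  "Linf T = {u. u \<in> borel_measurable (lebesgue_on {0<..<T}) \<and>
               (\<exists>C. AE t in lebesgue_on {0<..<T}. norm (u t) \<le> C)}"

definition convolution :: "(real^2 \<Rightarrow> complex) \<Rightarrow> (real^2 \<Rightarrow> complex) \<Rightarrow> real^2 \<Rightarrow> complex" where
  "convolution f g x = (LINT y|lebesgue. f (x - y) * g y)"

definition heat_kernel :: "real \<Rightarrow> real^2 \<Rightarrow> complex" where
  "heat_kernel T x = complex_of_real (1 / (4 * pi * T) * exp (- (norm x)\<^sup>2 / (4 * T)))"

definition state_free :: "(real^2 \<Rightarrow> complex) \<Rightarrow> real^2 \<Rightarrow> real \<Rightarrow> complex" where
  "state_free W0 x T = convolution (heat_kernel T) W0 x"

text \<open>
  For \<open>u \<in> L\<^sup>\<infinity>(0,T)\<close> the integral below converges absolutely for every \<open>x \<noteq> 0\<close>. It may diverge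
  at \<open>x = 0\<close>, where the Bochner integral then takes the value 0; this is a null set.
\<close>

definition state_ctrl :: "(real \<Rightarrow> complex) \<Rightarrow> real^2 \<Rightarrow> real \<Rightarrow> complex" where
  "state_ctrl u x T =
     - (1 / complex_of_real pi) *
       (LINT \<xi>|lebesgue_on {0<..<T}.
          complex_of_real (1 / (2 * \<xi>) * exp (- (norm x)\<^sup>2 / (4 * \<xi>))) * u (T - \<xi>))"

definition controllable_to ::
    "(real^2 \<Rightarrow> complex) \<Rightarrow> (real^2 \<Rightarrow> complex) \<Rightarrow> real \<Rightarrow> bool" where
  "controllable_to W0 WT T \<longleftrightarrow>
     (\<exists>u \<in> Linf T. AE x in lebesgue. WT x = state_free W0 x T + state_ctrl u x T)"

end

theory Submission
  imports
    Defs
    "HOL-Probability.Distributions"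
    "HOL-Complex_Analysis.Conformal_Mappings"
    "HOL-Real_Asymp.Real_Asymp"
begin

text \<open>
  Let \<open>W\<^sub>0(\<cdot>,T) = - W\<^sub>u(\<cdot>,T)\<close> almost everywhere. Integrating both sides against the heat kernel
  of time \<open>\<tau> = a - T\<close> centred at the origin and using the semigroup property gives, for real \<open>a > T\<close>,
  that \<open>1/(2a) \<integral> exp(-|z|\<^sup>2/(4a)) W\<^sup>0(z) dz\<close> equals the Stieltjes transform \<open>\<integral> u(t)/(a - t) dt\<close>,
  taken over \<open>(0,T)\<close>. The left side is holomorphic on \<open>Re a > 0\<close>, so the Stieltjes transform has no
  jump across \<open>(0,T)\<close>. This jump is \<open>-2\<pi>i u\<close>, hence \<open>u = 0\<close>.
  Then \<open>W\<^sub>0(\<cdot>,T) = 0\<close>, and convolving further shows \<open>W\<^sub>0(\<cdot>,a) = 0\<close> for all \<open>a > T\<close>. By analyticity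
  in \<open>1/(4a)\<close> this persists for all \<open>a > 0\<close>, and \<open>a \<rightarrow> 0\<close> gives \<open>W\<^sup>0 = 0\<close>.
\<close>

section \<open>Integration\<close>

text \<open>The balance of states holds only almost everywhere, and the control term may be singular
  at the origin, so it is used only under integrals against heat kernels. These turn the control
  term into an explicit kernel: two heat kernels of times \<tau> and \<xi>, both centred at 0, pair
  to 1/(4 pi (\<tau> + \<xi>)), and \<xi> = T - t makes this a multiple of 1/(a - t). Any other
  centre would add an exponential factor, so the control is determined from the origin alone;
  recovering the initial state afterwards takes all centres.

  Neither unknown is regular: the control is merely bounded and measurable, the initial state merely
  square integrable. Pointwise inversion of the two transforms is therefore avoided. In both cases
  the smoothing kernel is moved by Fubini onto the indicator of a box, where its limit is explicit
  off a null set, and a function whose integrals over boxes vanish is zero almost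
  everywhere.\<close>

lemma Fubini_lborel:
  fixes F :: "'a::euclidean_space \<Rightarrow> 'b::euclidean_space \<Rightarrow> complex"
  assumes [measurable]: "case_prod F \<in> borel_measurable (lborel \<Otimes>\<^sub>M lborel)"
    and "\<And>x. integrable lborel (F x)"
    and "integrable lborel (\<lambda>x. \<integral>y. norm (F x y) \<partial>lborel)"
  shows "(\<integral>x. \<integral>y. F x y \<partial>lborel \<partial>lborel) = (\<integral>y. \<integral>x. F x y \<partial>lborel \<partial>lborel)"
proof -
  have "integrable (lborel \<Otimes>\<^sub>M lborel) (case_prod F)"
    using assms by (intro lborel_pair.Fubini_integrable) auto
  then show ?thesis
    by (rule lborel_pair.Fubini_integral[symmetric])
qed

text \<open>A local bound on the integrand alone is enough: Cauchy's inequality turns it into a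
  bound on the derivative in the parameter, hence on difference quotients, and dominated convergence
  differentiates under the integral.\<close>

lemma holomorphic_on_integral:
  fixes f :: "complex \<Rightarrow> 'a \<Rightarrow> complex"
  assumes D: "open D"
    and meas: "\<And>a. a \<in> D \<Longrightarrow> f a \<in> borel_measurable M"
    and hol: "\<And>z. z \<in> space M \<Longrightarrow> (\<lambda>a. f a z) holomorphic_on D"
    and dom: "\<And>a. a \<in> D \<Longrightarrow> \<exists>r>0. \<exists>h. cball a r \<subseteq> D \<and> integrable M h \<and>
                (\<forall>b\<in>cball a r. \<forall>z\<in>space M. norm (f b z) \<le> h z)"
  shows "(\<lambda>a. \<integral>z. f a z \<partial>M) holomorphic_on D"
  unfolding holomorphic_on_open[OF D]
proof (intro ballI)
  fix a assume a: "a \<in> D"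
  obtain r h where r: "r > 0" "cball a r \<subseteq> D" and h: "integrable M h"
    and bd: "\<And>b z. b \<in> cball a r \<Longrightarrow> z \<in> space M \<Longrightarrow> norm (f b z) \<le> h z"
    using dom[OF a] by blast
  \<comment> \<open>Half the radius leaves room for a closed ball of radius \<open>r / 2\<close>
    about each point of \<open>B\<close>; Cauchy's inequality on it produces the factor
    \<open>2 / r\<close>.\<close>
  define B where "B = ball a (r / 2)"
  have BD: "B \<subseteq> cball a r" "B \<subseteq> D" and aB: "a \<in> B"
    using r by (auto simp: B_def)
  have int: "integrable M (f b)" if "b \<in> cball a r" for b
    by (rule Bochner_Integration.integrable_bound[OF h])
      (use that r bd in \<open>auto intro!: meas order_trans[OF _ abs_ge_self]\<close>)
  have deriv_le: "norm (deriv (\<lambda>a. f a z) b) \<le> 2 * h z / r" if "b \<in> B" "z \<in> space M" for b z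
  proof -
    have sub: "cball b (r / 2) \<subseteq> cball a r"
      using that r by (intro cball_subset_cball_iff[THEN iffD2]) (auto simp: B_def dist_commute)
    have hb: "(\<lambda>a. f a z) holomorphic_on cball b (r / 2)"
      using hol[OF that(2)] holomorphic_on_subset sub r(2) by blast
    have "norm ((deriv ^^ 1) (\<lambda>a. f a z) b) \<le> fact 1 * h z / (r / 2) ^ 1"
    proof (rule Cauchy_inequality)
      show "(\<lambda>a. f a z) holomorphic_on ball b (r / 2)"
        using hb ball_subset_cball holomorphic_on_subset by blast
      show "continuous_on (cball b (r / 2)) (\<lambda>a. f a z)"
        using hb by (rule holomorphic_on_imp_continuous_on)
      show "norm (f x z) \<le> h z" if "norm (b - x) = r / 2" for x
        using sub that \<open>z \<in> space M\<close> by (intro bd) (auto simp: dist_norm subset_iff)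
    qed (use r in auto)
    then show ?thesis by (simp add: mult.commute)
  qed
  have lip: "norm (f b z - f a z) \<le> (2 * h z / r) * norm (b - a)" if "b \<in> B" "z \<in> space M" for b z
  proof (rule field_differentiable_bound[where f = "\<lambda>a. f a z" and f' = "deriv (\<lambda>a. f a z)" and S = B])
    show "((\<lambda>a. f a z) has_field_derivative deriv (\<lambda>a. f a z) w) (at w within B)" if "w \<in> B" for w
      using hol[OF \<open>z \<in> space M\<close>] D that BD
      by (auto intro: holomorphic_derivI[where S = D])
  qed (use that deriv_le aB in \<open>auto simp: B_def\<close>)
  have "((\<lambda>b. ((\<integral>z. f b z \<partial>M) - (\<integral>z. f a z \<partial>M)) / (b - a)) \<longlongrightarrow>
          (\<integral>z. deriv (\<lambda>a. f a z) a \<partial>M)) (at a within B)"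
    unfolding tendsto_at_iff_sequentially
  proof (intro allI impI)
    fix X :: "nat \<Rightarrow> complex" assume X: "\<forall>i. X i \<in> B - {a}" "X \<longlonglongrightarrow> a"
    have Xc: "X i \<in> cball a r" "X i \<in> D" "X i \<in> B" "X i \<noteq> a" for i
      using X(1) BD by auto
    define q where "q = (\<lambda>i z. (f (X i) z - f a z) / (X i - a))"
    have q_meas: "q i \<in> borel_measurable M" for i
      unfolding q_def using meas[OF a] meas[OF Xc(2)] by measurable
    have q_lim: "(\<lambda>i. q i z) \<longlonglongrightarrow> deriv (\<lambda>a. f a z) a" if "z \<in> space M" for z
    proof -
      have "((\<lambda>a. f a z) has_field_derivative deriv (\<lambda>a. f a z) a) (at a)"
        using hol[OF that] D a by (intro holomorphic_derivI)
      then have "((\<lambda>b. (f b z - f a z) / (b - a)) \<longlongrightarrow> deriv (\<lambda>a. f a z) a) (at a)"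
        by (simp add: has_field_derivative_iff)
      from this[unfolded tendsto_at_iff_sequentially, rule_format, of X]
      show ?thesis using X by (auto simp: q_def o_def)
    qed
    have "(\<lambda>i. \<integral>z. q i z \<partial>M) \<longlonglongrightarrow> (\<integral>z. deriv (\<lambda>a. f a z) a \<partial>M)"
    proof (rule integral_dominated_convergence[where w = "\<lambda>z. 2 * h z / r"])
      \<comment> \<open>Measurability of the derivative is not assumed; it is inherited from the
        difference quotients, which converge to it pointwise.\<close>
      show "(\<lambda>z. deriv (\<lambda>a. f a z) a) \<in> borel_measurable M"
        by (rule borel_measurable_LIMSEQ_metric[OF q_meas q_lim])
      show "integrable M (\<lambda>z. 2 * h z / r)" using h by auto
      show "AE z in M. norm (q i z) \<le> 2 * h z / r" for i
        using lip[OF Xc(3)[of i]] Xc(4)[of i] by (intro AE_I2) (simp add: q_def norm_divide pos_divide_le_eq)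
    qed (use q_lim q_meas in auto)
    moreover have "(\<integral>z. q i z \<partial>M) = ((\<integral>z. f (X i) z \<partial>M) - (\<integral>z. f a z \<partial>M)) / (X i - a)" for i
      using int[OF Xc(1)] int[of a] r by (simp add: q_def)
    ultimately show "((\<lambda>b. ((\<integral>z. f b z \<partial>M) - (\<integral>z. f a z \<partial>M)) / (b - a)) \<circ> X) \<longlonglongrightarrow>
          (\<integral>z. deriv (\<lambda>a. f a z) a \<partial>M)"
      by (simp add: o_def)
  qed
  moreover have "at a within B = at a"
    using aB by (intro at_within_open) (auto simp: B_def)
  ultimately show "\<exists>f'. ((\<lambda>a. \<integral>z. f a z \<partial>M) has_field_derivative f') (at a)"
    by (auto simp: has_field_derivative_iff)
qed

section \<open>Detecting zero functions by their integrals over boxes\<close>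

lemma mem_box_One_if_norm_less:
  fixes x :: "'a::euclidean_space"
  assumes "norm x < r"
  shows "x \<in> box (- (r *\<^sub>R One)) (r *\<^sub>R One)"
proof -
  have "\<bar>x \<bullet> b\<bar> < r" if "b \<in> Basis" for b
    using Basis_le_norm[OF that, of x] assms by linarith
  then show ?thesis by (fastforce simp: mem_box abs_less_iff)
qed

text \<open>A Dynkin argument: boxes form an intersection-stable generator of the Borel sets, and
  the sets over which \<open>f\<close> integrates to zero are closed under complements and disjoint
  countable unions.\<close>

lemma AE_zero_if_box_integrals_zero:
  fixes f :: "'a::euclidean_space \<Rightarrow> 'b::{banach, second_countable_topology}"
  assumes f: "integrable lborel f"
    and box: "\<And>a b. (\<integral>x. indicator (box a b) x *\<^sub>R f x \<partial>lborel) = 0"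
  shows "AE x in lborel. f x = 0"
proof (rule sigma_finite_measure.density_zero[OF sigma_finite_lborel f])
  have [measurable]: "f \<in> borel_measurable borel" using f by auto
  have int: "integrable lborel (\<lambda>x. indicator A x *\<^sub>R f x)" if "A \<in> sets borel" for A
    using that f by (intro integrable_mult_indicator) auto
  \<comment> \<open>The whole space is not a box, so the complement step needs its integral
    separately, as a limit over growing boxes.\<close>
  have total: "(\<integral>x. f x \<partial>lborel) = 0"
  proof (rule LIMSEQ_unique)
    show "(\<lambda>n. \<integral>x. indicator (box (- (real n *\<^sub>R One)) (real n *\<^sub>R One)) x *\<^sub>R f x \<partial>lborel) \<longlonglongrightarrow> (\<integral>x. f x \<partial>lborel)"
    proof (rule integral_dominated_convergence[where w = "\<lambda>x. norm (f x)"])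
      show "AE x in lborel. (\<lambda>n. indicator (box (- (real n *\<^sub>R One)) (real n *\<^sub>R One)) x *\<^sub>R f x) \<longlonglongrightarrow> f x"
      proof (intro AE_I2 tendsto_eventually)
        fix x :: 'a
        obtain N :: nat where N: "norm x < real N" using reals_Archimedean2 by blast
        have "x \<in> box (- (real n *\<^sub>R One)) (real n *\<^sub>R One)" if "n \<ge> N" for n
          by (rule mem_box_One_if_norm_less) (use N that in linarith)
        then show "\<forall>\<^sub>F n in sequentially. indicator (box (- (real n *\<^sub>R One)) (real n *\<^sub>R One)) x *\<^sub>R f x = f x"
          by (auto simp: eventually_sequentially intro!: exI[of _ N])
      qed
    qed (use f in \<open>auto simp: indicator_def\<close>)
  qed (simp add: box)
  have Int: "Int_stable (range (\<lambda>(a, b). box a b :: 'a set))"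
    by (auto simp: Int_stable_def box_Int_box)
  have Pow: "range (\<lambda>(a, b). box a b :: 'a set) \<subseteq> Pow UNIV"
    by simp
  fix A :: "'a set" assume "A \<in> sets lborel"
  then have "A \<in> sigma_sets UNIV (range (\<lambda>(a, b). box a b))"
    by (simp add: borel_eq_box)
  then have "A \<in> sets borel \<and> (\<integral>x. indicator A x *\<^sub>R f x \<partial>lborel) = 0"
  proof (induction rule: sigma_sets_induct_disjoint[OF Int Pow, consumes 1, case_names basic empty compl union])
    case (compl A)
    have "indicator (UNIV - A) x *\<^sub>R f x = f x - indicator A x *\<^sub>R f x" for x
      by (auto simp: indicator_def)
    then show ?case using compl f int[of A] total sets.Diff[of UNIV borel A] by simp
  next
    case (union A)
    then have m: "A i \<in> sets borel" for i by blast
    have "set_lebesgue_integral lborel (\<Union>i. A i) f = (\<Sum>i. set_lebesgue_integral lborel (A i) f)"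
      using union(1) m int[of "\<Union>i. A i"]
      by (intro lebesgue_integral_countable_add) (auto simp: disjoint_family_on_def set_integrable_def)
    then show ?case using union m by (auto simp: set_lebesgue_integral_def)
  qed (auto simp: box)
  then show "set_lebesgue_integral lborel A f = 0"
    by (simp add: set_lebesgue_integral_def)
qed

section \<open>Gaussian integrals on the plane\<close>

lemma nn_integral_exp_square:
  fixes a :: real
  assumes "a > 0"
  shows "(\<integral>\<^sup>+ x. ennreal (exp (- a * x\<^sup>2)) \<partial>lborel) = ennreal (sqrt (pi / a))"
proof -
  \<comment> \<open>The standard deviation for which the exponent of the centred normal density is
    \<open>- a * x\<^sup>2\<close>.\<close>
  define \<sigma> where "\<sigma> = 1 / sqrt (2 * a)"
  have \<sigma>: "\<sigma> > 0" "\<sigma>\<^sup>2 = 1 / (2 * a)"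
    using assms by (auto simp: \<sigma>_def power_divide)
  have eq: "exp (- a * x\<^sup>2) = sqrt (pi / a) * normal_density 0 \<sigma> x" for x
    using assms by (simp add: normal_density_def \<sigma> field_simps real_sqrt_divide)
  show ?thesis
    unfolding eq using assms \<sigma>
    by (subst nn_integral_eq_integral) auto
qed

text \<open>The Gaussian factors over the coordinates, and the two one-dimensional factors sqrt(pi /
  a) multiply to pi / a.\<close>

lemma has_bochner_integral_gaussian:
  fixes a :: real
  assumes "a > 0"
  shows "has_bochner_integral lborel (\<lambda>x::real^2. exp (- a * (norm x)\<^sup>2)) (pi / a)"
proof (rule has_bochner_integral_nn_integral)
  have "exp (- a * (norm x)\<^sup>2) = (\<Prod>b\<in>Basis. exp (- a * (x \<bullet> b)\<^sup>2))" for x :: "real^2"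
    unfolding power2_norm_eq_inner
    by (subst euclidean_inner) (simp add: exp_sum[symmetric] sum_distrib_left power2_eq_square sum_negf)
  then have "(\<integral>\<^sup>+ x. ennreal (exp (- a * (norm (x :: real^2))\<^sup>2)) \<partial>lborel) =
      (\<integral>\<^sup>+ x. (\<Prod>b\<in>(Basis::(real^2) set). ennreal (exp (- a * (x \<bullet> b)\<^sup>2))) \<partial>lborel)"
    by (simp add: prod_ennreal)
  also have "\<dots> = (\<Prod>b\<in>(Basis::(real^2) set). ennreal (sqrt (pi / a)))"
    by (subst nn_integral_lborel_prod) (simp_all add: nn_integral_exp_square[OF assms, simplified])
  also have "\<dots> = ennreal (pi / a)"
    using assms by (simp add: ennreal_power)
  finally show "(\<integral>\<^sup>+ x. ennreal (exp (- a * (norm (x :: real^2))\<^sup>2)) \<partial>lborel) = ennreal (pi / a)" .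
qed (use assms in auto)

section \<open>The real-valued heat kernel and its semigroup law\<close>

definition heat :: "real \<Rightarrow> real^2 \<Rightarrow> real" where
  "heat t x = 1 / (4 * pi * t) * exp (- (norm x)\<^sup>2 / (4 * t))"

lemma heat_nonneg [simp]: "t > 0 \<Longrightarrow> heat t x \<ge> 0"
  by (simp add: heat_def)

text \<open>Completing the square in \<open>x\<close>: the rates 1/(4s) and 1/(4t) add up to
  \<open>b\<close>, the centre \<open>c\<close> is the mean of \<open>p\<close> and \<open>z\<close>
  with weights t/(s+t) and s/(s+t), and what remains is a Gaussian in \<open>p - z\<close> of time
  \<open>s + t\<close>.\<close>

lemma heat_semigroup:
  assumes "s > 0" "t > 0"
  shows "has_bochner_integral lborel (\<lambda>x. heat s (p - x) * heat t (x - z)) (heat (s + t) (p - z))"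
proof -
  define c where "c = z + (t / (s + t)) *\<^sub>R (p - z)"
  define b where "b = (s + t) / (4 * s * t)"
  have b: "b > 0" using assms by (simp add: b_def)
  have quad: "(norm (p - x))\<^sup>2 / (4 * s) + (norm (x - z))\<^sup>2 / (4 * t)
      = b * (norm (- c + x))\<^sup>2 + (norm (p - z))\<^sup>2 / (4 * (s + t))" for x
  proof -
    define d y where "d = p - z" and "y = x - z"
    have *: "p - x = d - y" "x - z = y" "- c + x = y - (t / (s + t)) *\<^sub>R d" "p - z = d"
      by (auto simp: d_def y_def c_def)
    have e: "(norm (y - k *\<^sub>R d))\<^sup>2 = y \<bullet> y - 2 * k * (d \<bullet> y) + k\<^sup>2 * (d \<bullet> d)" for k
      unfolding power2_norm_eq_inner
      by (simp add: algebra_simps power2_eq_square inner_commute)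
    have e': "(norm (d - y))\<^sup>2 = d \<bullet> d - 2 * (d \<bullet> y) + y \<bullet> y"
      unfolding power2_norm_eq_inner by (simp add: algebra_simps inner_commute)
    have st: "s + t \<noteq> 0" using assms by simp
    show ?thesis
      unfolding * e e' b_def using assms st
      by (simp add: power2_norm_eq_inner divide_simps) (simp add: algebra_simps power2_eq_square)
  qed
  have eq: "heat s (p - x) * heat t (x - z) =
      exp (- b * (norm (- c + x))\<^sup>2) * (1 / (4 * pi * s) * (1 / (4 * pi * t)) *
        exp (- (norm (p - z))\<^sup>2 / (4 * (s + t))))" for x
    using quad[of x] by (simp add: heat_def exp_add[symmetric] algebra_simps)
  have "has_bochner_integral lborel (\<lambda>x. exp (- b * (norm (- c + x))\<^sup>2)) (pi / b)"
    using has_bochner_integral_gaussian[OF b]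
    by (subst (asm) lborel_distr_plus[of "- c", symmetric])
      (simp add: has_bochner_integral_iff integrable_distr_eq integral_distr)
  from has_bochner_integral_mult_left[OF this]
  have "has_bochner_integral lborel (\<lambda>x. heat s (p - x) * heat t (x - z))
      (pi / b * (1 / (4 * pi * s) * (1 / (4 * pi * t)) * exp (- (norm (p - z))\<^sup>2 / (4 * (s + t)))))"
    unfolding eq .
  also have "pi / b * (1 / (4 * pi * s) * (1 / (4 * pi * t)) * exp (- (norm (p - z))\<^sup>2 / (4 * (s + t))))
      = heat (s + t) (p - z)"
    using assms by (simp add: heat_def b_def)
  finally show ?thesis .
qed

section \<open>Gauss transforms of square integrable functions\<close>

lemma integrable_exp_mult_L2:
  fixes w :: "real^2 \<Rightarrow> complex"
  assumes [measurable]: "w \<in> borel_measurable borel" and w: "integrable lborel (\<lambda>z. (norm (w z))\<^sup>2)" and b: "b > 0"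
  shows "integrable lborel (\<lambda>z. exp (- b * (norm (p - z))\<^sup>2) *\<^sub>R w z)"
proof (rule Bochner_Integration.integrable_bound)
  have "integrable lborel (\<lambda>z::real^2. exp (- (2 * b) * (norm z)\<^sup>2))"
    using has_bochner_integral_gaussian[of "2 * b"] b by (simp add: has_bochner_integral_iff)
  then have "integrable (distr lborel borel ((+) (- p))) (\<lambda>z::real^2. exp (- (2 * b) * (norm z)\<^sup>2))"
    by (simp add: lborel_distr_plus)
  then have "integrable lborel (\<lambda>z. exp (- (2 * b) * (norm (- p + z))\<^sup>2))"
    by (subst (asm) integrable_distr_eq) auto
  then show "integrable lborel (\<lambda>z. exp (- (2 * b) * (norm (p - z))\<^sup>2) + (norm (w z))\<^sup>2)"
    using w by (intro Bochner_Integration.integrable_add) (simp_all add: norm_minus_commute)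
  \<comment> \<open>A square integrable function need not be integrable; xy \<le> x^2 + y^2 bounds
    the product by two integrable terms, because the square of a Gaussian is a Gaussian of twice the
    rate.\<close>
  have "exp (- b * (norm (p - z))\<^sup>2) * norm (w z) \<le> exp (- (2 * b) * (norm (p - z))\<^sup>2) + (norm (w z))\<^sup>2" for z
  proof -
    have *: "exp (- (2 * b) * (norm (p - z))\<^sup>2) = (exp (- b * (norm (p - z))\<^sup>2))\<^sup>2"
      by (simp add: power2_eq_square exp_add[symmetric])
    have "2 * (x * y) \<le> x\<^sup>2 + y\<^sup>2" for x y :: real
      using sum_squares_bound[of x y] by simp
    from this[of "exp (- b * (norm (p - z))\<^sup>2)" "norm (w z)"] show ?thesis
      unfolding * by (smt (verit) exp_gt_zero mult_nonneg_nonneg norm_ge_zero)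
  qed
  then show "AE z in lborel. norm (exp (- b * (norm (p - z))\<^sup>2) *\<^sub>R w z) \<le>
      norm (exp (- (2 * b) * (norm (p - z))\<^sup>2) + (norm (w z))\<^sup>2)"
    by (intro AE_I2) (simp add: order_trans[OF _ abs_ge_self])
qed measurable

lemma holomorphic_on_gauss_transform:
  fixes w :: "real^2 \<Rightarrow> complex"
  assumes [measurable]: "w \<in> borel_measurable borel" and w: "integrable lborel (\<lambda>z. (norm (w z))\<^sup>2)"
  shows "(\<lambda>b. \<integral>z. exp (- b * of_real ((norm (p - z))\<^sup>2)) * w z \<partial>lborel) holomorphic_on {b. Re b > 0}"
proof (rule holomorphic_on_integral)
  show "open {b. Re b > 0}" by (rule open_halfspace_Re_gt)
  fix a :: complex assume a: "a \<in> {b. Re b > 0}"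
  show "(\<lambda>z. exp (- a * of_real ((norm (p - z))\<^sup>2)) * w z) \<in> borel_measurable lborel"
    by measurable
  show "\<exists>r>0. \<exists>h. cball a r \<subseteq> {b. Re b > 0} \<and> integrable lborel h \<and>
      (\<forall>b\<in>cball a r. \<forall>z\<in>space lborel. norm (exp (- b * of_real ((norm (p - z))\<^sup>2)) * w z) \<le> h z)"
  \<comment> \<open>The modulus of the exponential depends only on \<open>Re b\<close>, which is at
    least \<open>Re a / 2\<close> on this ball, so the real Gaussian of rate \<open>Re a / 2\<close>
    dominates.\<close>
  proof (intro exI[of _ "Re a / 2"] exI[of _ "\<lambda>z. norm (exp (- (Re a / 2) * (norm (p - z))\<^sup>2) *\<^sub>R w z)"] conjI ballI)
    have Re: "Re b \<ge> Re a / 2" if "b \<in> cball a (Re a / 2)" for b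
      using that abs_Re_le_cmod[of "a - b"] by (simp add: dist_norm)
    then show "cball a (Re a / 2) \<subseteq> {b. Re b > 0}" using a by force
    show "norm (exp (- b * of_real ((norm (p - z))\<^sup>2)) * w z)
        \<le> norm (exp (- (Re a / 2) * (norm (p - z))\<^sup>2) *\<^sub>R w z)" if "b \<in> cball a (Re a / 2)" for b z
      using mult_right_mono[OF Re[OF that] zero_le_power2[of "norm (p - z)"]]
      by (simp add: norm_mult mult_right_mono)
    show "integrable lborel (\<lambda>z. norm (exp (- (Re a / 2) * (norm (p - z))\<^sup>2) *\<^sub>R w z))"
      using a by (intro integrable_norm integrable_exp_mult_L2[OF assms]) auto
  qed (use a in auto)
next
  fix z show "(\<lambda>b. exp (- b * of_real ((norm (p - z))\<^sup>2)) * w z) holomorphic_on {b. Re b > 0}"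
    by (intro holomorphic_intros)
qed

text \<open>The identity theorem on the right half-plane. Since the rate is b = 1/(4a), small rates
  are large times: vanishing at late times propagates back to all positive times.\<close>

lemma gauss_transform_zero_extend:
  fixes w :: "real^2 \<Rightarrow> complex"
  assumes w: "w \<in> borel_measurable borel" "integrable lborel (\<lambda>z. (norm (w z))\<^sup>2)"
    and "b0 > 0" and zero: "\<And>b. 0 < b \<Longrightarrow> b < b0 \<Longrightarrow> (\<integral>z. exp (- b * (norm (p - z))\<^sup>2) *\<^sub>R w z \<partial>lborel) = 0"
    and "b > 0"
  shows "(\<integral>z. exp (- b * (norm (p - z))\<^sup>2) *\<^sub>R w z \<partial>lborel) = 0"
proof -
  define H where "H = (\<lambda>b. \<integral>z. exp (- b * of_real ((norm (p - z))\<^sup>2)) * w z \<partial>lborel)"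
  have H: "H (of_real b) = (\<integral>z. exp (- b * (norm (p - z))\<^sup>2) *\<^sub>R w z \<partial>lborel)" for b
    by (simp add: H_def scaleR_conv_of_real flip: of_real_mult of_real_minus of_real_power exp_of_real)
  have "H (of_real b) = 0"
  proof (rule analytic_continuation[where f = H and w = "of_real b"])
    show "H holomorphic_on {b. Re b > 0}"
      unfolding H_def by (rule holomorphic_on_gauss_transform[OF w])
    show "open {b. Re b > 0}" by (rule open_halfspace_Re_gt)
    show "connected {b. Re b > 0}" by (intro convex_connected convex_halfspace_Re_gt)
    show "of_real ` {0<..<b0} \<subseteq> {b. Re b > 0}" by auto
    show "complex_of_real (b0 / 2) \<in> {b. Re b > 0}" using \<open>b0 > 0\<close> by simp
    show "complex_of_real (b0 / 2) islimpt of_real ` {0<..<b0}"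
      unfolding islimpt_approachable
    proof (intro allI impI)
      fix d :: real assume "d > 0"
      \<comment> \<open>A shift by \<open>min d b0 / 4\<close> is nonzero, smaller than
        \<open>d\<close>, and keeps the point below \<open>b0\<close>.\<close>
      define x where "x = b0 / 2 + min d b0 / 4"
      show "\<exists>x'\<in>of_real ` {0<..<b0}. x' \<noteq> complex_of_real (b0 / 2) \<and> dist x' (complex_of_real (b0 / 2)) < d"
        using \<open>d > 0\<close> \<open>b0 > 0\<close>
        by (intro bexI[of _ "of_real x"] imageI)
          (auto simp: dist_norm x_def min_def simp del: of_real_divide of_real_add simp flip: of_real_diff)
    qed
    show "H z = 0" if "z \<in> of_real ` {0<..<b0}" for z
      using that zero by (auto simp: H)
  qed (use \<open>b > 0\<close> in auto)
  then show ?thesis by (simp add: H)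
qed

section \<open>Injectivity of the Gauss transform\<close>

lemma lborel_integral_affine_plane:
  fixes f :: "real^2 \<Rightarrow> real"
  assumes [measurable]: "f \<in> borel_measurable borel" and c: "c > 0"
  shows "(\<integral>x. f x \<partial>lborel) = c\<^sup>2 * (\<integral>y. f (z + c *\<^sub>R y) \<partial>lborel)"
proof -
  have "(\<integral>x. f x \<partial>lborel) = (\<integral>x. f x \<partial>density (distr lborel borel (\<lambda>y. z + c *\<^sub>R y)) (\<lambda>_. ennreal (c\<^sup>2)))"
    using c by (subst lborel_affine[of c z]) auto
  also have "\<dots> = (\<integral>x. c\<^sup>2 *\<^sub>R f x \<partial>distr lborel borel (\<lambda>y. z + c *\<^sub>R y))"
    by (rule integral_density) auto
  also have "\<dots> = c\<^sup>2 * (\<integral>y. f (z + c *\<^sub>R y) \<partial>lborel)"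
    by (subst integral_distr) auto
  finally show ?thesis .
qed

text \<open>Gaussians of rate n + 1 form an approximate identity up to normalisation. Integrating
  the transform in \<open>p\<close> over a box and applying Fubini puts the smoothing on the
  indicator of the box, so no convergence of smoothed versions of \<open>w\<close> itself is
  needed.\<close>

lemma gauss_transform_inj:
  fixes w :: "real^2 \<Rightarrow> complex"
  assumes w: "w \<in> borel_measurable borel" "integrable lborel (\<lambda>z. (norm (w z))\<^sup>2)"
    and zero: "\<And>b p. 0 < b \<Longrightarrow> (\<integral>z. exp (- b * (norm (p - z))\<^sup>2) *\<^sub>R w z \<partial>lborel) = 0"
  shows "AE z in lborel. w z = 0"
proof -
  have [measurable]: "w \<in> borel_measurable borel" by fact
  have int_box: "integrable lborel (\<lambda>z. indicator (box l u) z *\<^sub>R w z)" for l u :: "real^2"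
  proof (rule Bochner_Integration.integrable_bound)
    have "integrable lborel (indicator (box l u) :: real^2 \<Rightarrow> real)"
      by (intro integrable_real_indicator) (auto simp: emeasure_lborel_box_eq)
    then show "integrable lborel (\<lambda>z. indicator (box l u) z + (norm (w z))\<^sup>2)"
      using w(2) by auto
    have "x \<le> 1 + x\<^sup>2" for x :: real
      using sum_squares_bound[of x 1] by (simp, smt (verit) zero_le_power2)
    then show "AE z in lborel. norm (indicator (box l u) z *\<^sub>R w z) \<le> norm (indicator (box l u) z + (norm (w z))\<^sup>2)"
      by (intro AE_I2) (auto simp: indicator_def)
  qed measurable
  have box_zero: "(\<integral>z. indicator (box l u) z *\<^sub>R w z \<partial>lborel) = 0" for l u :: "real^2"
  proof -
    define Q where "Q = box l u"
    have [measurable]: "Q \<in> sets borel" by (simp add: Q_def)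
    obtain R where R: "\<And>x. x \<in> Q \<Longrightarrow> norm x \<le> R"
      using bounded_box[of l u] by (auto simp: bounded_iff Q_def)
    \<comment> \<open>The length scale of the Gaussian of rate \<open>Suc n\<close>; its square is
      the Jacobian of the scaling in the plane. \<open>Suc\<close> avoids rate zero and keeps the
      scale at most 1, as the bound on \<open>g\<close> requires.\<close>
    define c where "c = (\<lambda>n. 1 / sqrt (real (Suc n)))"
    have c: "c n > 0" "c n \<le> 1" "(c n)\<^sup>2 = 1 / real (Suc n)" for n
      by (auto simp: c_def power_divide)
    have c_lim: "c \<longlonglongrightarrow> 0" unfolding c_def by real_asymp
    define g where "g = (\<lambda>n z y. indicator Q (z + c n *\<^sub>R y) * exp (- 1 * (norm (y :: real^2))\<^sup>2))"
    define K where "K = (\<lambda>n z. \<integral>y. g n z y \<partial>lborel)"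
    have [measurable]: "case_prod (g n) \<in> borel_measurable (borel \<Otimes>\<^sub>M borel)" for n
      unfolding g_def by measurable
    have gauss1: "integrable lborel (\<lambda>y::real^2. exp (- 1 * (norm y)\<^sup>2))" "(\<integral>y. exp (- 1 * (norm (y::real^2))\<^sup>2) \<partial>lborel) = pi"
      using has_bochner_integral_gaussian[of 1] by (simp_all add: has_bochner_integral_iff)
    have gauss2: "integrable lborel (\<lambda>y::real^2. exp (- (1/2) * (norm y)\<^sup>2))" "(\<integral>y. exp (- (1/2) * (norm (y::real^2))\<^sup>2) \<partial>lborel) = 2 * pi"
      using has_bochner_integral_gaussian[of "1/2"] by (simp_all add: has_bochner_integral_iff)
    have g_nonneg: "g n z y \<ge> 0" for n z y by (simp add: g_def)
    have g_int: "integrable lborel (g n z)" for n z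
      by (rule Bochner_Integration.integrable_bound[OF gauss1(1)])
        (auto simp: g_def indicator_def)
    \<comment> \<open>Half of the decay in \<open>y\<close> is traded for decay in \<open>z\<close>:
      on the support |z| \<le> R + |y|, hence |z|^2 / 4 \<le> R^2 / 2 + |y|^2 / 2. This makes
      \<open>K n z *\<^sub>R w z\<close> dominated uniformly in \<open>n\<close> by a Gaussian times
      \<open>norm (w z)\<close>.\<close>
    have g_bd: "g n z y \<le> exp (R\<^sup>2 / 2) * exp (- (1/4) * (norm z)\<^sup>2) * exp (- (1/2) * (norm y)\<^sup>2)" for n z y
    proof (cases "z + c n *\<^sub>R y \<in> Q")
      case True
      have "norm z \<le> norm (z + c n *\<^sub>R y) + norm (c n *\<^sub>R y)"
        using norm_triangle_ineq4[of "z + c n *\<^sub>R y" "c n *\<^sub>R y"] by simp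
      also have "\<dots> \<le> R + norm y"
        using R[OF True] c[of n] by (intro add_mono) (auto intro: mult_left_le_one_le)
      finally have "(norm z)\<^sup>2 \<le> (R + norm y)\<^sup>2" by (intro power_mono) auto
      also have "\<dots> \<le> 2 * R\<^sup>2 + 2 * (norm y)\<^sup>2"
        using sum_squares_bound[of R "norm y"] by (simp add: power2_sum)
      finally have "- 1 * (norm y)\<^sup>2 \<le> R\<^sup>2 / 2 + - (1/4) * (norm z)\<^sup>2 + - (1/2) * (norm y)\<^sup>2"
        by simp
      then show ?thesis using True by (simp add: g_def exp_add[symmetric])
    qed (simp add: g_def)
    have K_nonneg: "K n z \<ge> 0" for n z
      unfolding K_def by (intro Bochner_Integration.integral_nonneg g_nonneg)
    have K_bd: "K n z \<le> exp (R\<^sup>2 / 2) * (2 * pi) * exp (- (1/4) * (norm z)\<^sup>2)" for n z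
    proof -
      have "K n z \<le> (\<integral>y. exp (R\<^sup>2 / 2) * exp (- (1/4) * (norm z)\<^sup>2) * exp (- (1/2) * (norm (y :: real^2))\<^sup>2) \<partial>lborel)"
        unfolding K_def
      proof (rule Bochner_Integration.integral_mono)
        show "integrable lborel (\<lambda>y::real^2. exp (R\<^sup>2 / 2) * exp (- (1/4) * (norm z)\<^sup>2) * exp (- (1/2) * (norm y)\<^sup>2))"
          by (intro integrable_mult_right gauss2(1))
      qed (rule g_int g_bd)+
      also have "\<dots> = exp (R\<^sup>2 / 2) * (2 * pi) * exp (- (1/4) * (norm z)\<^sup>2)"
        by (subst integral_mult_right_zero) (simp only: gauss2(2) mult_ac)
      finally show ?thesis .
    qed
    have [measurable]: "K n \<in> borel_measurable borel" for n
      unfolding K_def by measurable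
    define m where "m = (\<lambda>z. exp (R\<^sup>2 / 2) * (2 * pi) * norm (exp (- (1/4) * (norm (0 - z))\<^sup>2) *\<^sub>R w z))"
    have m: "integrable lborel m"
      unfolding m_def by (intro integrable_mult_right integrable_norm integrable_exp_mult_L2[OF w]) simp
    have Kw_bd: "norm (K n z *\<^sub>R w z) \<le> m z" for n z
      using mult_right_mono[OF K_bd[of n z] norm_ge_zero[of "w z"]] K_nonneg[of n z]
      by (simp add: m_def mult_ac)
    have scaled: "(\<integral>x. indicator Q x * exp (- real (Suc n) * (norm (x - z))\<^sup>2) \<partial>lborel) = K n z / real (Suc n)" for n z
    proof -
      have "real (Suc n) * (norm (z + c n *\<^sub>R y - z))\<^sup>2 = (norm y)\<^sup>2" for y
        using c(3)[of n] by (simp add: power_mult_distrib)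
      then have *: "exp (- real (Suc n) * (norm (z + c n *\<^sub>R y - z))\<^sup>2) = exp (- 1 * (norm y)\<^sup>2)" for y
        by (simp only: mult_minus_left mult_1)
      have "(\<integral>x. indicator Q x * exp (- real (Suc n) * (norm (x - z))\<^sup>2) \<partial>lborel)
          = (c n)\<^sup>2 * (\<integral>y. indicator Q (z + c n *\<^sub>R y) * exp (- real (Suc n) * (norm (z + c n *\<^sub>R y - z))\<^sup>2) \<partial>lborel)"
        by (rule lborel_integral_affine_plane) (auto simp: c)
      then show ?thesis by (simp only: * c K_def g_def) simp
    qed
    have Kw_zero: "(\<integral>z. K n z *\<^sub>R w z \<partial>lborel) = 0" for n
    proof -
      define F where "F = (\<lambda>z x. (indicator Q x * exp (- real (Suc n) * (norm (x - z))\<^sup>2)) *\<^sub>R w z)"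
      have int: "integrable lborel (\<lambda>x. indicator Q x * exp (- real (Suc n) * (norm (x - z))\<^sup>2))" for z
      proof (rule Bochner_Integration.integrable_bound)
        show "integrable lborel (indicator Q :: real^2 \<Rightarrow> real)"
          unfolding Q_def by (intro integrable_real_indicator) (auto simp: emeasure_lborel_box_eq)
      qed (auto simp: indicator_def mult_nonpos_nonneg)
      have swap: "(\<integral>z. \<integral>x. F z x \<partial>lborel \<partial>lborel) = (\<integral>x. \<integral>z. F z x \<partial>lborel \<partial>lborel)"
      proof (rule Fubini_lborel)
        show "case_prod F \<in> borel_measurable (lborel \<Otimes>\<^sub>M lborel)"
          unfolding F_def by measurable
        show "integrable lborel (F z)" for z
          unfolding F_def using int by (intro integrable_scaleR_left)
        have "(\<integral>x. norm (F z x) \<partial>lborel) = norm (K n z *\<^sub>R w z) / real (Suc n)" for z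
        proof -
          have "norm (F z x) = indicator Q x * exp (- real (Suc n) * (norm (x - z))\<^sup>2) * norm (w z)" for x
            by (simp add: F_def)
          then show ?thesis using K_nonneg[of n z] by (simp only: integral_mult_left_zero scaled) simp
        qed
        moreover have "integrable lborel (\<lambda>z. norm (K n z *\<^sub>R w z) / real (Suc n))"
          by (intro integrable_divide integrable_norm Bochner_Integration.integrable_bound[OF m])
            (use Kw_bd in \<open>auto intro!: order_trans[OF _ abs_ge_self]\<close>)
        ultimately show "integrable lborel (\<lambda>z. \<integral>x. norm (F z x) \<partial>lborel)" by simp
      qed
      \<comment> \<open>For fixed \<open>x\<close> this is a multiple of the Gauss transform centred
        at \<open>x\<close>, which vanishes by hypothesis.\<close>
      have outer: "(\<integral>z. F z x \<partial>lborel) = 0" for x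
      proof -
        have "F z x = indicator Q x *\<^sub>R (exp (- real (Suc n) * (norm (x - z))\<^sup>2) *\<^sub>R w z)" for z
          by (simp add: F_def)
        then show ?thesis using zero[of "real (Suc n)" x] by (simp only: integral_scaleR_right) simp
      qed
      have inner: "(\<integral>x. F z x \<partial>lborel) = (1 / real (Suc n)) *\<^sub>R (K n z *\<^sub>R w z)" for z
        unfolding F_def using scaled[of n z] by (subst integral_scaleR_left[OF int]) simp
      show ?thesis using swap unfolding inner outer integral_scaleR_right by simp
    qed
    have K_lim: "(\<lambda>n. K n z) \<longlonglongrightarrow> pi * indicator Q z" if z: "z \<notin> frontier Q" for z
    proof -
      have "(\<lambda>n. K n z) \<longlonglongrightarrow> (\<integral>y. indicator Q z * exp (- 1 * (norm (y::real^2))\<^sup>2) \<partial>lborel)"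
        unfolding K_def
      proof (rule integral_dominated_convergence[where w = "\<lambda>y. exp (- 1 * (norm y)\<^sup>2)"])
        show "AE y in lborel. (\<lambda>n. g n z y) \<longlonglongrightarrow> indicator Q z * exp (- 1 * (norm y)\<^sup>2)"
        proof (intro AE_I2 tendsto_eventually)
          fix y
          have lim: "(\<lambda>n. z + c n *\<^sub>R y) \<longlonglongrightarrow> z"
            using tendsto_add[OF tendsto_const[of z] tendsto_scaleR[OF c_lim tendsto_const[of y]]] by simp
          have "\<forall>\<^sub>F n in sequentially. indicator Q (z + c n *\<^sub>R y) = (indicator Q z :: real)"
          proof (cases "z \<in> Q")
            case True
            then have "\<forall>\<^sub>F n in sequentially. z + c n *\<^sub>R y \<in> Q"
              by (intro topological_tendstoD[OF lim]) (auto simp: Q_def)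
            then show ?thesis by eventually_elim (use True in simp)
          next
            case False
            then have "z \<in> - closure Q"
              using z interior_subset by (auto simp: frontier_def)
            then have "\<forall>\<^sub>F n in sequentially. z + c n *\<^sub>R y \<in> - closure Q"
              by (intro topological_tendstoD[OF lim]) auto
            then show ?thesis
              by eventually_elim (use False closure_subset in \<open>auto simp: indicator_def\<close>)
          qed
          then show "\<forall>\<^sub>F n in sequentially. g n z y = indicator Q z * exp (- 1 * (norm y)\<^sup>2)"
            by eventually_elim (simp add: g_def)
        qed
      qed (use gauss1 in \<open>auto simp: g_def indicator_def\<close>)
      then show ?thesis using gauss1(2) by (simp add: mult.commute)
    qed
    have "(\<lambda>n. \<integral>z. K n z *\<^sub>R w z \<partial>lborel) \<longlonglongrightarrow> (\<integral>z. (pi * indicator Q z) *\<^sub>R w z \<partial>lborel)"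
    proof (rule integral_dominated_convergence[OF _ _ m])
      \<comment> \<open>On the frontier the points \<open>z + c n *\<^sub>R y\<close> may lie on
        either side of the box, depending on \<open>y\<close>, so the limit of \<open>K n z\<close>
        is claimed only off this null set.\<close>
      have "negligible (frontier Q)" unfolding Q_def by (intro negligible_convex_frontier convex_box)
      then have "AE z in lebesgue. z \<notin> frontier Q"
        by (intro AE_not_in) (simp add: negligible_iff_null_sets)
      then have "AE z in lborel. z \<notin> frontier Q"
        by (simp add: AE_completion_iff)
      then show "AE z in lborel. (\<lambda>n. K n z *\<^sub>R w z) \<longlonglongrightarrow> (pi * indicator Q z) *\<^sub>R w z"
        by eventually_elim (intro tendsto_scaleR K_lim tendsto_const)
    qed (use Kw_bd in auto)
    then have "(\<integral>z. (pi * indicator Q z) *\<^sub>R w z \<partial>lborel) = 0"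
      by (simp add: Kw_zero LIMSEQ_const_iff)
    then have "pi *\<^sub>R (\<integral>z. indicator Q z *\<^sub>R w z \<partial>lborel) = 0"
      by (simp flip: integral_scaleR_right)
    then show ?thesis by (simp add: Q_def)
  qed
  \<comment> \<open>\<open>w\<close> need not be integrable on the whole plane, so the box criterion
    is applied to its restrictions to growing boxes; an intersection of boxes is again a
    box.\<close>
  have "AE z in lborel. indicator (box (- (real n *\<^sub>R One)) (real n *\<^sub>R One)) z *\<^sub>R w z = 0" for n
  proof (rule AE_zero_if_box_integrals_zero[OF int_box])
    fix l u :: "real^2"
    have "indicator (box l u) z *\<^sub>R indicator (box a b) z *\<^sub>R w z = indicator (box l u \<inter> box a b) z *\<^sub>R w z" for a b z
      by (auto simp: indicator_def)
    then show "(\<integral>z. indicator (box l u) z *\<^sub>R indicator (box (- (real n *\<^sub>R One)) (real n *\<^sub>R One)) z *\<^sub>R w z \<partial>lborel) = 0"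
      by (simp only: box_Int_box box_zero)
  qed
  then have "AE z in lborel. \<forall>n. indicator (box (- (real n *\<^sub>R One)) (real n *\<^sub>R One)) z *\<^sub>R w z = 0"
    by (subst AE_all_countable) simp
  then show ?thesis
  proof eventually_elim
    case (elim z)
    obtain n :: nat where "norm z < real n" using reals_Archimedean2 by blast
    then have "z \<in> box (- (real n *\<^sub>R One)) (real n *\<^sub>R One)" by (rule mem_box_One_if_norm_less)
    then show ?case using elim[rule_format, of n] by simp
  qed
qed

section \<open>The Stieltjes transform\<close>

text \<open>Away from the closed slit the denominators are locally bounded below, so a multiple of
  \<open>norm (f t)\<close> dominates.\<close>

lemma holomorphic_on_stieltjes:
  fixes f :: "real \<Rightarrow> complex"
  assumes f: "integrable lborel f" and supp: "\<And>t. t \<notin> {0<..<T} \<Longrightarrow> f t = 0"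
  shows "(\<lambda>a. \<integral>t. f t / (a - of_real t) \<partial>lborel) holomorphic_on (- (of_real ` {0..T}))"
proof (rule holomorphic_on_integral)
  have [measurable]: "f \<in> borel_measurable borel" using f by auto
  show op: "open (- (complex_of_real ` {0..T}))"
    by (intro open_Compl compact_imp_closed compact_continuous_image continuous_intros) auto
  fix a :: complex assume a: "a \<in> - (of_real ` {0..T})"
  show "(\<lambda>t. f t / (a - of_real t)) \<in> borel_measurable lborel"
    by measurable
  obtain r where r: "r > 0" "cball a r \<subseteq> - (of_real ` {0..T})"
    using a op open_contains_cball by blast
  show "\<exists>r>0. \<exists>h. cball a r \<subseteq> - (of_real ` {0..T}) \<and> integrable lborel h \<and>
          (\<forall>b\<in>cball a r. \<forall>t\<in>space lborel. norm (f t / (b - of_real t)) \<le> h t)"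
  proof (intro exI[of _ "r / 2"] exI[of _ "\<lambda>t. norm (f t) / (r / 2)"] conjI ballI)
    show "integrable lborel (\<lambda>t. norm (f t) / (r / 2))"
      using f by auto
    show "cball a (r / 2) \<subseteq> - (of_real ` {0..T})"
      using r by (intro order_trans[OF subset_cball r(2)]) auto
    fix b :: complex and t :: real assume b: "b \<in> cball a (r / 2)"
    show "norm (f t / (b - of_real t)) \<le> norm (f t) / (r / 2)"
    proof (cases "t \<in> {0<..<T}")
      case True
      then have "of_real t \<notin> cball a r" using r by force
      then have "dist a (of_real t) > r" by simp
      then have "norm (b - of_real t) \<ge> r / 2"
        using b dist_triangle[of a "of_real t" b] by (simp add: dist_norm)
      then show ?thesis
        using r unfolding norm_divide by (intro frac_le) auto
    qed (simp add: supp)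
  qed (use r in auto)
next
  fix t :: real
  show "(\<lambda>a. f t / (a - of_real t)) holomorphic_on - (of_real ` {0..T})"
  proof (cases "t \<in> {0<..<T}")
    case True
    then show ?thesis by (intro holomorphic_intros) auto
  qed (simp add: supp)
qed

section \<open>The Poisson kernel integrated over an interval\<close>

lemma integral_poisson_kernel:
  fixes e :: real
  assumes "e > 0" "\<alpha> \<le> \<beta>"
  shows "(\<integral>t. e / ((t - s)\<^sup>2 + e\<^sup>2) * indicator {\<alpha>..\<beta>} t \<partial>lborel)
           = arctan ((\<beta> - s) / e) - arctan ((\<alpha> - s) / e)"
proof (rule integral_FTC_Icc_real)
  fix t :: real
  have "(t - s)\<^sup>2 + e\<^sup>2 \<noteq> 0" using assms by simp
  then show "isCont (\<lambda>t. e / ((t - s)\<^sup>2 + e\<^sup>2)) t"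
    by (intro continuous_intros)
  have *: "1 + ((t - s) / e)\<^sup>2 \<noteq> 0"
    using zero_le_power2[of "(t - s) / e"] by linarith
  show "DERIV (\<lambda>t. arctan ((t - s) / e)) t :> e / ((t - s)\<^sup>2 + e\<^sup>2)"
    using assms * \<open>(t - s)\<^sup>2 + e\<^sup>2 \<noteq> 0\<close>
    by (auto intro!: derivative_eq_intros simp: divide_simps power2_eq_square)
qed (use assms in auto)

text \<open>Each arctangent tends to pi/2 or -pi/2 according to the sign of its numerator. At an
  endpoint one numerator is zero and the limit would be pi/2, which is why the endpoints are
  excluded.\<close>

lemma tendsto_arctan_diff:
  assumes "\<alpha> < \<beta>" "s \<noteq> \<alpha>" "s \<noteq> \<beta>"
  shows "(\<lambda>n. arctan ((\<beta> - s) / inverse (real (Suc n))) - arctan ((\<alpha> - s) / inverse (real (Suc n))))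
           \<longlonglongrightarrow> pi * indicator {\<alpha><..<\<beta>} s"
proof -
  have pos: "(\<lambda>n. arctan (c / inverse (real (Suc n)))) \<longlonglongrightarrow> pi / 2" if "c > 0" for c
  proof (rule filterlim_compose[OF tendsto_arctan_at_top])
    have "filterlim (\<lambda>n. c * real (Suc n)) at_top sequentially"
      using that by real_asymp
    then show "filterlim (\<lambda>n. c / inverse (real (Suc n))) at_top sequentially"
      by (simp add: divide_inverse)
  qed
  have neg: "(\<lambda>n. arctan (c / inverse (real (Suc n)))) \<longlonglongrightarrow> - (pi / 2)" if "c < 0" for c
    using tendsto_minus[OF pos[of "- c"]] that by (simp add: arctan_minus)
  consider "s < \<alpha>" | "\<alpha> < s" "s < \<beta>" | "\<beta> < s" using assms by linarith
  then show ?thesis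
  proof cases
    case 1
    then show ?thesis using tendsto_diff[OF pos[of "\<beta> - s"] pos[of "\<alpha> - s"]] assms by simp
  next
    case 2
    then show ?thesis using tendsto_diff[OF pos[of "\<beta> - s"] neg[of "\<alpha> - s"]] assms by simp
  next
    case 3
    then show ?thesis using tendsto_diff[OF neg[of "\<beta> - s"] neg[of "\<alpha> - s"]] assms by simp
  qed
qed


text \<open>\<open>A\<close> is a continuation that ignores the slit: it agrees with the Stieltjes
  transform off the slit and is continuous across it. As \<open>f\<close> is only integrable, the
  resulting absence of a jump is exploited after integration over intervals.\<close>

lemma stieltjes_transform_inj:
  fixes f :: "real \<Rightarrow> complex"
  assumes T: "T > 0" and f: "integrable lborel f" and supp: "\<And>t. t \<notin> {0<..<T} \<Longrightarrow> f t = 0"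
    and A: "A holomorphic_on {a. Re a > 0}"
    and eq: "\<And>a. a > T \<Longrightarrow> A (of_real a) = (\<integral>t. f t / (of_real a - of_real t) \<partial>lborel)"
  shows "AE t in lborel. f t = 0"
proof -
  have [measurable]: "f \<in> borel_measurable borel" using f by auto
  define S where "S = (\<lambda>a. \<integral>t. f t / (a - of_real t) \<partial>lborel)"
  define D where "D = {a. Re a > 0} \<inter> - (complex_of_real ` {0..T})"
  have in_D: "complex_of_real x \<in> D" if "x > T" for x
    using that T by (auto simp: D_def)
  have AS: "A a = S a" if "a \<in> D" for a
  proof -
    have D_open: "open D"
      unfolding D_def
      by (intro open_Int open_halfspace_Re_gt open_Compl compact_imp_closed
          compact_continuous_image continuous_intros) auto
    have star: "starlike D"
      \<comment> \<open>Connectedness comes from the centre \<open>T + 1\<close>, on the real axis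
        to the right of the slit: a segment from it to \<open>x\<close> meets the axis elsewhere
        only if \<open>x\<close> is real, and then \<open>x\<close> exceeds \<open>T\<close> as
        well.\<close>
      unfolding starlike_def
    proof (intro bexI ballI subsetI)
      show "complex_of_real (T + 1) \<in> D" by (rule in_D) simp
      fix x z assume x: "x \<in> D" and z: "z \<in> closed_segment (complex_of_real (T + 1)) x"
      from z obtain u where u: "0 \<le> u" "u \<le> 1" "z = (1 - u) *\<^sub>R complex_of_real (T + 1) + u *\<^sub>R x"
        by (auto simp: closed_segment_def)
      have Re: "Re z = (1 - u) * (T + 1) + u * Re x" and Im: "Im z = u * Im x"
        by (auto simp: u(3))
      have "Re z > 0"
        using u x T unfolding Re D_def
        by (cases "u = 0") (auto intro!: add_nonneg_pos)
      moreover have "z \<notin> of_real ` {0..T}"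
      proof
        assume "z \<in> of_real ` {0..T}"
        then have "Im z = 0" "Re z \<le> T" by auto
        with Im consider "u = 0" | "Im x = 0" by auto
        then show False
        proof cases
          case 1 then show False using \<open>Re z \<le> T\<close> Re by simp
        next
          case 2
          then have "x = of_real (Re x)" by (simp add: complex_eq_iff)
          then have "Re x > T" using x unfolding D_def
            by (metis (mono_tags, lifting) Compl_iff IntE atLeastAtMost_iff imageI less_imp_le mem_Collect_eq not_le)
          have "(1 - u) * (T + 1) + u * Re x > T"
          proof -
            have "(1 - u) * (T + 1) + u * Re x - T = (1 - u) + u * (Re x - T)"
              by (simp add: algebra_simps)
            also have "\<dots> > 0"
              using u \<open>Re x > T\<close> by (cases "u = 0") (auto intro!: add_nonneg_pos)
            finally show ?thesis by simp
          qed
          then show False using \<open>Re z \<le> T\<close> Re by simp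
        qed
      qed
      ultimately show "z \<in> D" by (simp add: D_def)
    qed
    have hol: "(\<lambda>a. A a - S a) holomorphic_on D"
    proof (intro holomorphic_on_diff)
      show "A holomorphic_on D" using A by (rule holomorphic_on_subset) (auto simp: D_def)
      show "S holomorphic_on D"
        unfolding S_def
        using holomorphic_on_stieltjes[OF f supp] by (rule holomorphic_on_subset) (auto simp: D_def)
    qed
    have "A a - S a = 0"
    proof (rule analytic_continuation[OF hol D_open starlike_imp_connected[OF star] _ _ _ _ that])
      show "of_real ` {T<..} \<subseteq> D" using in_D by auto
      show "complex_of_real (T + 1) \<in> D" by (rule in_D) simp
      show "complex_of_real (T + 1) islimpt of_real ` {T<..}"
        unfolding islimpt_approachable
      proof (intro allI impI)
        fix d :: real assume "d > 0"
        then show "\<exists>x'\<in>of_real ` {T<..}. x' \<noteq> complex_of_real (T + 1) \<and> dist x' (complex_of_real (T + 1)) < d"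
          by (intro bexI[of _ "of_real (T + 1 + d / 2)"] imageI)
            (auto simp: dist_norm simp flip: of_real_diff of_real_add)
      qed
      show "A z - S z = 0" if "z \<in> of_real ` {T<..}" for z
        using that eq by (auto simp: S_def)
    qed
    then show ?thesis by simp
  qed
  have interval: "(\<integral>t. indicator {\<alpha><..<\<beta>} t *\<^sub>R f t \<partial>lborel) = 0" if "0 < \<alpha>" "\<alpha> < \<beta>" for \<alpha> \<beta> :: real
  proof -
    \<comment> \<open>Plemelj: \<open>S(t + i\<epsilon>) - S(t - i\<epsilon>)\<close> is \<open>-2i\<close> times the Poisson integral of \<open>f\<close>; integrate it over \<open>[\<alpha>,\<beta>]\<close> and let \<open>\<epsilon> \<rightarrow> 0\<close>.\<close>
    define e :: "nat \<Rightarrow> real" where "e = (\<lambda>n. inverse (real (Suc n)))"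
    have e: "e n > 0" "e n \<le> 1" for n by (auto simp: e_def divide_simps)
    have e_lim: "e \<longlonglongrightarrow> 0" unfolding e_def by (rule LIMSEQ_inverse_real_of_nat)
    have ind: "integrable lborel (indicator {\<alpha>..\<beta>} :: real \<Rightarrow> real)"
      by (intro integrable_real_indicator) (auto simp: emeasure_lborel_Icc_eq)
    define J where "J = (\<lambda>n t. indicator {\<alpha>..\<beta>} t *\<^sub>R (A (Complex t (e n)) - A (Complex t (- e n))))"
    have contA: "continuous_on {a. Re a > 0} A" using A by (rule holomorphic_on_imp_continuous_on)
    have J_lim: "(\<lambda>n. \<integral>t. J n t \<partial>lborel) \<longlonglongrightarrow> 0"
    proof -
      \<comment> \<open>Since \<alpha> > 0 and the heights \<open>e n\<close> are at most 1, all
        points at which \<open>A\<close> is evaluated lie in one compact rectangle of the right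
        half-plane; this supplies the dominating constant.\<close>
      have cpt: "compact (A ` cbox (Complex \<alpha> (-1)) (Complex \<beta> 1))"
        using that by (intro compact_continuous_image continuous_on_subset[OF contA]) (auto simp: in_cbox_complex_iff)
      then obtain C where C: "\<And>a. a \<in> cbox (Complex \<alpha> (-1)) (Complex \<beta> 1) \<Longrightarrow> norm (A a) \<le> C"
        using compact_imp_bounded[OF cpt] by (auto simp: bounded_iff)
      have "(\<lambda>n. \<integral>t. J n t \<partial>lborel) \<longlonglongrightarrow> (\<integral>t. 0 \<partial>(lborel :: real measure))"
      proof (rule integral_dominated_convergence[where w = "\<lambda>t. indicator {\<alpha>..\<beta>} t *\<^sub>R (2 * C)"])
        show "integrable lborel (\<lambda>t. indicator {\<alpha>..\<beta>} t *\<^sub>R (2 * C))" using ind by simp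
        show "J n \<in> borel_measurable lborel" for n
        proof -
          have "continuous_on {\<alpha>..\<beta>} (\<lambda>t. A (Complex t y))" for y
            using that by (intro continuous_on_compose2[OF contA]) (auto simp: Complex_eq intro: continuous_intros)
          then have "continuous_on {\<alpha>..\<beta>} (\<lambda>t. A (Complex t (e n)) - A (Complex t (- e n)))"
            by (intro continuous_on_diff)
          then show ?thesis unfolding J_def
            using borel_measurable_continuous_on_indicator[of "{\<alpha>..\<beta>}"] by simp
        qed
        show "AE t in lborel. norm (J n t) \<le> indicator {\<alpha>..\<beta>} t *\<^sub>R (2 * C)" for n
        proof (intro AE_I2)
          fix t
          show "norm (J n t) \<le> indicator {\<alpha>..\<beta>} t *\<^sub>R (2 * C)"
          proof (cases "t \<in> {\<alpha>..\<beta>}")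
            case True
            have "norm (A (Complex t (e n)) - A (Complex t (- e n))) \<le> C + C"
              using True e[of n] by (intro order_trans[OF norm_triangle_ineq4] add_mono C)
                (auto simp: in_cbox_complex_iff)
            then show ?thesis using True by (simp add: J_def)
          qed (simp add: J_def)
        qed
        show "AE t in lborel. (\<lambda>n. J n t) \<longlonglongrightarrow> 0"
        proof (intro AE_I2)
          fix t
          show "(\<lambda>n. J n t) \<longlonglongrightarrow> 0"
          proof (cases "t \<in> {\<alpha>..\<beta>}")
            case True
            then have iso: "isCont A (of_real t)"
              using contA that by (simp add: continuous_on_eq_continuous_at open_halfspace_Re_gt)
            have "(\<lambda>n. Complex t (e n)) \<longlonglongrightarrow> of_real t" "(\<lambda>n. Complex t (- e n)) \<longlonglongrightarrow> of_real t"
              using tendsto_Complex[OF tendsto_const e_lim, of t]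
                tendsto_Complex[OF tendsto_const tendsto_minus[OF e_lim], of t]
              by (simp_all add: complex_of_real_def)
            then have "(\<lambda>n. A (Complex t (e n)) - A (Complex t (- e n))) \<longlonglongrightarrow> A (of_real t) - A (of_real t)"
              by (intro tendsto_diff isCont_tendsto_compose[OF iso])
            then show ?thesis using True by (simp add: J_def)
          qed (simp add: J_def)
        qed
      qed auto
      then show ?thesis by simp
    qed
    \<comment> \<open>Up to the factor 1/pi this is the Poisson kernel of the upper half-plane at
      height \<open>e n\<close>.\<close>
    define P where "P = (\<lambda>n t s. e n / ((t - s)\<^sup>2 + (e n)\<^sup>2))"
    have P_nonneg: "P n t s \<ge> 0" for n t s using e[of n] by (simp add: P_def)
    have P_le: "P n t s \<le> 1 / e n" for n t s
    proof -
      have "P n t s \<le> e n / (e n)\<^sup>2"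
        unfolding P_def using e[of n] by (intro divide_left_mono) (auto intro!: mult_pos_pos add_nonneg_pos)
      then show ?thesis using e[of n] by (simp add: power2_eq_square)
    qed
    define \<Theta> where "\<Theta> = (\<lambda>n s. arctan ((\<beta> - s) / e n) - arctan ((\<alpha> - s) / e n))"
    have \<Theta>_le: "\<bar>\<Theta> n s\<bar> \<le> pi" for n s
      using arctan_lbound[of "(\<beta> - s) / e n"] arctan_ubound[of "(\<beta> - s) / e n"]
        arctan_lbound[of "(\<alpha> - s) / e n"] arctan_ubound[of "(\<alpha> - s) / e n"]
      by (simp add: \<Theta>_def)
    have P_int: "(\<integral>t. indicator {\<alpha>..\<beta>} t * P n t s \<partial>lborel) = \<Theta> n s" for n s
      using integral_poisson_kernel[of "e n" \<alpha> \<beta> s] e[of n] that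
      by (simp add: P_def \<Theta>_def mult.commute)
    have P_integrable: "integrable lborel (\<lambda>t. indicator {\<alpha>..\<beta>} t * P n t s)" for n s
    proof (rule Bochner_Integration.integrable_bound)
      show "integrable lborel (\<lambda>t. indicator {\<alpha>..\<beta>} t *\<^sub>R (1 / e n))" using ind by simp
      show "(\<lambda>t. indicator {\<alpha>..\<beta>} t * P n t s) \<in> borel_measurable lborel"
        unfolding P_def by measurable
      show "AE t in lborel. norm (indicator {\<alpha>..\<beta>} t * P n t s) \<le> norm (indicator {\<alpha>..\<beta>} t *\<^sub>R (1 / e n))"
        using P_nonneg P_le e[of n] by (intro AE_I2) (auto simp: indicator_def)
    qed
    have J_eq: "(\<integral>t. J n t \<partial>lborel) = -2 * \<i> * (\<integral>s. of_real (\<Theta> n s) * f s \<partial>lborel)" for n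
    proof -
      have jump: "A (Complex t (e n)) - A (Complex t (- e n)) = -2 * \<i> * (\<integral>s. of_real (P n t s) * f s \<partial>lborel)"
        if "t \<in> {\<alpha>..\<beta>}" for t
      proof -
        have int: "integrable lborel (\<lambda>s. f s / (Complex t y - of_real s))" if "y \<noteq> 0" for y
        proof (rule Bochner_Integration.integrable_bound)
          show "integrable lborel (\<lambda>s. norm (f s) / \<bar>y\<bar>)" using f by auto
          have "\<bar>y\<bar> \<le> norm (Complex t y - of_real s)" for s
            using abs_Im_le_cmod[of "Complex t y - of_real s"] by simp
          then show "AE s in lborel. norm (f s / (Complex t y - of_real s)) \<le> norm (norm (f s) / \<bar>y\<bar>)"
            using that unfolding norm_divide by (intro AE_I2) (auto intro!: frac_le)
        qed simp
        have D: "Complex t y \<in> D" if "y \<noteq> 0" for y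
          using that \<open>t \<in> {\<alpha>..\<beta>}\<close> \<open>0 < \<alpha>\<close> by (auto simp: D_def complex_eq_iff)
        have "A (Complex t (e n)) - A (Complex t (- e n))
            = (\<integral>s. f s / (Complex t (e n) - of_real s) - f s / (Complex t (- e n) - of_real s) \<partial>lborel)"
          using e[of n] by (simp add: AS D int S_def)
        also have "\<dots> = (\<integral>s. -2 * \<i> * (of_real (P n t s) * f s) \<partial>lborel)"
        proof (rule Bochner_Integration.integral_cong)
          fix s
          have nz: "Complex t (e n) - of_real s \<noteq> 0" "Complex t (- e n) - of_real s \<noteq> 0"
            using e[of n] by (auto simp: complex_eq_iff)
          \<comment> \<open>The two denominators are complex conjugates, so their product is the
            real denominator of the Poisson kernel, while their difference contributes -2i times
            \<open>e n\<close>.\<close>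
          have prod: "(Complex t (e n) - of_real s) * (Complex t (- e n) - of_real s) = of_real ((t - s)\<^sup>2 + (e n)\<^sup>2)"
            by (simp add: complex_eq_iff power2_eq_square algebra_simps)
          have "f s / (Complex t (e n) - of_real s) - f s / (Complex t (- e n) - of_real s)
              = f s * (Complex t (- e n) - Complex t (e n)) /
                ((Complex t (e n) - of_real s) * (Complex t (- e n) - of_real s))"
            using nz by (simp add: field_simps)
          also have "Complex t (- e n) - Complex t (e n) = - 2 * \<i> * of_real (e n)"
            by (simp add: complex_eq_iff)
          finally show "f s / (Complex t (e n) - of_real s) - f s / (Complex t (- e n) - of_real s)
              = -2 * \<i> * (of_real (P n t s) * f s)"
            unfolding prod by (simp add: P_def)
        qed simp
        finally show ?thesis by simp
      qed
      have "(\<integral>t. J n t \<partial>lborel) = (\<integral>t. -2 * \<i> * (\<integral>s. of_real (indicator {\<alpha>..\<beta>} t * P n t s) * f s \<partial>lborel) \<partial>lborel)"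
        by (rule Bochner_Integration.integral_cong) (auto simp: J_def jump indicator_def)
      also have "\<dots> = -2 * \<i> * (\<integral>t. (\<integral>s. of_real (indicator {\<alpha>..\<beta>} t * P n t s) * f s \<partial>lborel) \<partial>lborel)"
        by (rule integral_mult_right_zero)
      also have "(\<integral>t. (\<integral>s. of_real (indicator {\<alpha>..\<beta>} t * P n t s) * f s \<partial>lborel) \<partial>lborel)
          = (\<integral>s. (\<integral>t. of_real (indicator {\<alpha>..\<beta>} t * P n t s) * f s \<partial>lborel) \<partial>lborel)"
      proof (rule Fubini_lborel[symmetric])
        show "(\<lambda>(s, t). complex_of_real (indicator {\<alpha>..\<beta>} t * P n t s) * f s)
            \<in> borel_measurable (lborel \<Otimes>\<^sub>M lborel)"
          unfolding P_def by measurable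
        show "integrable lborel (\<lambda>t. complex_of_real (indicator {\<alpha>..\<beta>} t * P n t s) * f s)" for s
          using P_integrable[of n s] by (intro integrable_mult_left integrable_of_real)
        have "(\<integral>t. norm (complex_of_real (indicator {\<alpha>..\<beta>} t * P n t s) * f s) \<partial>lborel) = \<Theta> n s * norm (f s)" for s
        proof -
          have "norm (complex_of_real (indicator {\<alpha>..\<beta>} t * P n t s) * f s) = indicator {\<alpha>..\<beta>} t * P n t s * norm (f s)" for t
            using P_nonneg[of n t s] by (simp add: norm_mult)
          then show ?thesis by (simp add: P_int)
        qed
        moreover have "integrable lborel (\<lambda>s. \<Theta> n s * norm (f s))"
        proof (rule Bochner_Integration.integrable_bound)
          show "integrable lborel (\<lambda>s. pi * norm (f s))" using f by auto
          show "AE s in lborel. norm (\<Theta> n s * norm (f s)) \<le> norm (pi * norm (f s))"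
            using \<Theta>_le by (intro AE_I2) (auto simp: abs_mult intro!: mult_right_mono)
          show "(\<lambda>s. \<Theta> n s * norm (f s)) \<in> borel_measurable lborel"
            unfolding \<Theta>_def by measurable
        qed
        ultimately show "integrable lborel (\<lambda>s. \<integral>t. norm (complex_of_real (indicator {\<alpha>..\<beta>} t * P n t s) * f s) \<partial>lborel)"
          by simp
      qed
      also have "\<dots> = (\<integral>s. of_real (\<Theta> n s) * f s \<partial>lborel)"
        unfolding integral_mult_left_zero integral_complex_of_real P_int ..
      finally show ?thesis .
    qed
    have "(\<lambda>n. \<integral>s. of_real (\<Theta> n s) * f s \<partial>lborel) \<longlonglongrightarrow> (\<integral>s. of_real (pi * indicator {\<alpha><..<\<beta>} s) * f s \<partial>lborel)"
    \<comment> \<open>After Fubini the singular kernel is replaced by the arctangent difference,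
      bounded by pi uniformly in \<open>n\<close>, so integrability of \<open>f\<close> suffices for
      the limit.\<close>
    proof (rule integral_dominated_convergence[where w = "\<lambda>s. pi * norm (f s)"])
      show "AE s in lborel. norm (of_real (\<Theta> n s) * f s) \<le> pi * norm (f s)" for n
        using \<Theta>_le by (simp add: norm_mult mult_right_mono)
      show "AE s in lborel. (\<lambda>n. of_real (\<Theta> n s) * f s) \<longlonglongrightarrow> of_real (pi * indicator {\<alpha><..<\<beta>} s) * f s"
        using AE_lborel_singleton[of \<alpha>] AE_lborel_singleton[of \<beta>]
      proof eventually_elim
        case (elim s)
        then show ?case unfolding \<Theta>_def e_def
          by (intro tendsto_mult tendsto_of_real tendsto_arctan_diff tendsto_const that)
      qed
    qed (use f in \<open>auto simp: \<Theta>_def\<close>)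
    moreover have "(\<lambda>n. \<integral>s. of_real (\<Theta> n s) * f s \<partial>lborel) \<longlonglongrightarrow> 0"
    proof -
      have "(\<integral>s. of_real (\<Theta> n s) * f s \<partial>lborel) = \<i> / 2 * (\<integral>t. J n t \<partial>lborel)" for n
        by (simp add: J_eq)
      then show ?thesis using tendsto_mult_right_zero[OF J_lim, of "\<i> / 2"] by (simp only:)
    qed
    ultimately have "(\<integral>s. of_real (pi * indicator {\<alpha><..<\<beta>} s) * f s \<partial>lborel) = 0"
      by (rule LIMSEQ_unique)
    moreover have "(\<integral>s. of_real (pi * indicator {\<alpha><..<\<beta>} s) * f s \<partial>lborel)
        = of_real pi * (\<integral>s. indicator {\<alpha><..<\<beta>} s *\<^sub>R f s \<partial>lborel)"
      by (simp add: mult.assoc scaleR_conv_of_real)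
    ultimately show ?thesis by simp
  qed
  \<comment> \<open>The interval identity needs a positive left end, because \<open>A\<close> is
    controlled only for positive real part; \<open>f\<close> is therefore cut off at \<delta>, and
    \<delta> then runs through a null sequence.\<close>
  have "AE t in lborel. indicator {\<delta><..} t *\<^sub>R f t = 0" if "\<delta> > 0" for \<delta> :: real
  proof (rule AE_zero_if_box_integrals_zero)
    show "integrable lborel (\<lambda>t. indicator {\<delta><..} t *\<^sub>R f t)"
      using f by (intro integrable_mult_indicator) auto
    fix a b :: real
    have "indicator (box a b) t *\<^sub>R indicator {\<delta><..} t *\<^sub>R f t = indicator {max a \<delta><..<b} t *\<^sub>R f t" for t
      by (auto simp: indicator_def)
    moreover have "(\<integral>t. indicator {max a \<delta><..<b} t *\<^sub>R f t \<partial>lborel) = 0"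
    proof (cases "max a \<delta> < b")
      case True
      then show ?thesis using interval[of "max a \<delta>" b] that by simp
    next
      case False
      then have "{max a \<delta><..<b} = {}" by auto
      then show ?thesis by simp
    qed
    ultimately show "(\<integral>t. indicator (box a b) t *\<^sub>R indicator {\<delta><..} t *\<^sub>R f t \<partial>lborel) = 0"
      by (simp only:)
  qed
  then have "AE t in lborel. \<forall>n. indicator {inverse (real (Suc n))<..} t *\<^sub>R f t = 0"
    by (subst AE_all_countable) simp
  then show ?thesis
  proof eventually_elim
    case (elim t)
    show ?case
    proof (cases "t > 0")
      case True
      then obtain n where "inverse (real (Suc n)) < t" using reals_Archimedean by blast
      then show ?thesis using elim[rule_format, of n] by simp
    qed (simp add: supp)
  qed
qed

section \<open>Null controllability\<close>

text \<open>Every use of Fubini below requires joint measurability for the product of two copies of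
  \<open>lborel\<close>, so Lebesgue measurable data are first replaced by Borel
  representatives.\<close>

lemma AE_eq_borel_complex:
  fixes f :: "'a::euclidean_space \<Rightarrow> complex"
  assumes "f \<in> borel_measurable lebesgue"
  obtains g where "g \<in> borel_measurable borel" "AE x in lborel. f x = g x"
proof -
  obtain r where r: "r \<in> borel_measurable lborel" "AE x in lborel. Re (f x) = r x"
    using completion_ex_borel_measurable_real[of "\<lambda>x. Re (f x)" lborel] assms by auto
  obtain i where i: "i \<in> borel_measurable lborel" "AE x in lborel. Im (f x) = i x"
    using completion_ex_borel_measurable_real[of "\<lambda>x. Im (f x)" lborel] assms by auto
  show thesis
  proof (rule that)
    show "(\<lambda>x. complex_of_real (r x) + \<i> * complex_of_real (i x)) \<in> borel_measurable borel"
      using r i by simp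
    show "AE x in lborel. f x = complex_of_real (r x) + \<i> * complex_of_real (i x)"
      using r(2) i(2) by eventually_elim (simp add: complex_eq_iff)
  qed
qed

lemma AE_lborel_reflect:
  fixes P :: "real \<Rightarrow> bool"
  assumes "AE t in lborel. P t"
  shows "AE t in lborel. P (T - t)"
proof -
  from assms obtain N where N: "{t. \<not> P t} \<subseteq> N" "N \<in> null_sets lborel"
    by (auto simp: eventually_ae_filter)
  then have "AE t in lborel. t \<notin> N" by (intro AE_not_in)
  then have "AE t in lborel. T + (-1) * t \<notin> N"
    using N(2) by (intro AE_borel_affine) (auto simp: null_sets_def)
  then show ?thesis by (rule eventually_mono) (use N(1) in auto)
qed

section \<open>Pairing the free and the controlled part with a heat kernel\<close>

lemma free_pairing:
  assumes w: "w \<in> borel_measurable borel" "integrable lborel (\<lambda>z. (norm (w z :: complex))\<^sup>2)"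
    and "\<tau> > 0" "T > 0"
  shows "(\<integral>x. heat \<tau> (p - x) *\<^sub>R (\<integral>z. heat T (x - z) *\<^sub>R w z \<partial>lborel) \<partial>lborel)
       = (\<integral>z. heat (\<tau> + T) (p - z) *\<^sub>R w z \<partial>lborel)"
proof -
  have [measurable]: "w \<in> borel_measurable borel" by fact
  note sg = heat_semigroup[OF \<open>\<tau> > 0\<close> \<open>T > 0\<close>, of p, unfolded has_bochner_integral_iff]
  have heat_w: "integrable lborel (\<lambda>z. heat (\<tau> + T) (p - z) *\<^sub>R w z)"
    using integrable_scaleR_right[OF integrable_exp_mult_L2[OF w, of "1 / (4 * (\<tau> + T))" p],
        of "1 / (4 * pi * (\<tau> + T))"] assms(3,4)
    by (simp add: heat_def)
  have swap: "(\<integral>z. (\<integral>x. (heat \<tau> (p - x) * heat T (x - z)) *\<^sub>R w z \<partial>lborel) \<partial>lborel)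
      = (\<integral>x. (\<integral>z. (heat \<tau> (p - x) * heat T (x - z)) *\<^sub>R w z \<partial>lborel) \<partial>lborel)"
  proof (rule Fubini_lborel)
    show "(\<lambda>(z, x). (heat \<tau> (p - x) * heat T (x - z)) *\<^sub>R w z) \<in> borel_measurable (lborel \<Otimes>\<^sub>M lborel)"
      unfolding heat_def by measurable
    show "integrable lborel (\<lambda>x. (heat \<tau> (p - x) * heat T (x - z)) *\<^sub>R w z)" for z
      using sg by (intro integrable_scaleR_left) auto
    \<comment> \<open>Heat kernels are nonnegative, so the absolute integral is the same semigroup
      computation with \<open>norm (w z)\<close>.\<close>
    have "(\<integral>x. norm ((heat \<tau> (p - x) * heat T (x - z)) *\<^sub>R w z) \<partial>lborel) = norm (heat (\<tau> + T) (p - z) *\<^sub>R w z)" for z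
    proof -
      have "norm ((heat \<tau> (p - x) * heat T (x - z)) *\<^sub>R w z) = (heat \<tau> (p - x) * heat T (x - z)) * norm (w z)" for x
        using assms(3,4) by simp
      then show ?thesis using sg assms(3,4) by (simp only: integral_mult_left_zero) simp
    qed
    then show "integrable lborel (\<lambda>z. \<integral>x. norm ((heat \<tau> (p - x) * heat T (x - z)) *\<^sub>R w z) \<partial>lborel)"
      using heat_w by (simp only: integrable_norm)
  qed
  have inner: "(\<integral>x. (heat \<tau> (p - x) * heat T (x - z)) *\<^sub>R w z \<partial>lborel) = heat (\<tau> + T) (p - z) *\<^sub>R w z" for z
    using sg by (subst integral_scaleR_left) auto
  have outer: "(\<integral>z. (heat \<tau> (p - x) * heat T (x - z)) *\<^sub>R w z \<partial>lborel)
      = heat \<tau> (p - x) *\<^sub>R (\<integral>z. heat T (x - z) *\<^sub>R w z \<partial>lborel)" for x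
    by (simp only: scaleR_scaleR[symmetric] integral_scaleR_right)
  from swap[unfolded inner outer] show ?thesis by simp
qed

text \<open>The value of the heat kernel of time \<tau> + \<xi> at the origin is 1/(4 pi (\<tau> +
  \<xi>)); this is where the Cauchy kernel originates.\<close>

lemma ctrl_pairing:
  fixes h :: "real \<Rightarrow> complex"
  assumes h: "integrable lborel h" and supp: "\<And>\<xi>. \<xi> \<le> 0 \<Longrightarrow> h \<xi> = 0" and "\<tau> > 0"
  shows "(\<integral>x. heat \<tau> x *\<^sub>R (\<integral>\<xi>. heat \<xi> x *\<^sub>R h \<xi> \<partial>lborel) \<partial>lborel)
       = (\<integral>\<xi>. h \<xi> / of_real (4 * pi * (\<tau> + \<xi>)) \<partial>lborel)"
proof -
  have [measurable]: "h \<in> borel_measurable borel" using h by auto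
  have heat_minus: "heat t (- x) = heat t x" for t x by (simp add: heat_def)
  have sg: "has_bochner_integral lborel (\<lambda>x. heat \<tau> x * heat \<xi> x) (1 / (4 * pi * (\<tau> + \<xi>)))" if "\<xi> > 0" for \<xi>
    using heat_semigroup[OF \<open>\<tau> > 0\<close> that, of 0 0] by (simp add: heat_minus) (simp add: heat_def)
  \<comment> \<open>Integrability is checked with \<xi> as the outer variable: for fixed \<xi> the
    product is Gaussian in \<open>x\<close>, whereas at \<open>x = 0\<close> the integral over \<xi>
    may diverge.\<close>
  have swap: "(\<integral>\<xi>. (\<integral>x. (heat \<tau> x * heat \<xi> x) *\<^sub>R h \<xi> \<partial>lborel) \<partial>lborel)
      = (\<integral>x. (\<integral>\<xi>. (heat \<tau> x * heat \<xi> x) *\<^sub>R h \<xi> \<partial>lborel) \<partial>lborel)"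
  proof (rule Fubini_lborel)
    show "(\<lambda>(\<xi>, x). (heat \<tau> x * heat \<xi> x) *\<^sub>R h \<xi>) \<in> borel_measurable (lborel \<Otimes>\<^sub>M lborel)"
      unfolding heat_def by measurable
    show "integrable lborel (\<lambda>x. (heat \<tau> x * heat \<xi> x) *\<^sub>R h \<xi>)" for \<xi>
      using sg[of \<xi>] supp[of \<xi>]
      by (cases "\<xi> > 0") (auto simp: has_bochner_integral_iff intro!: integrable_scaleR_left)
    have "(\<integral>x. norm ((heat \<tau> x * heat \<xi> x) *\<^sub>R h \<xi>) \<partial>lborel) = 1 / (4 * pi * (\<tau> + \<xi>)) * norm (h \<xi>)" for \<xi>
    proof (cases "\<xi> > 0")
      case True
      then have "norm ((heat \<tau> x * heat \<xi> x) *\<^sub>R h \<xi>) = (heat \<tau> x * heat \<xi> x) * norm (h \<xi>)" for x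
        using \<open>\<tau> > 0\<close> by simp
      then show ?thesis
        using sg[OF True] by (simp only: integral_mult_left_zero has_bochner_integral_iff)
    qed (simp add: supp)
    moreover have "integrable lborel (\<lambda>\<xi>. 1 / (4 * pi * (\<tau> + \<xi>)) * norm (h \<xi>))"
    proof (rule Bochner_Integration.integrable_bound)
      show "integrable lborel (\<lambda>\<xi>. norm (h \<xi>) / (4 * pi * \<tau>))" using h by auto
      have "norm (1 / (4 * pi * (\<tau> + \<xi>)) * norm (h \<xi>)) \<le> norm (norm (h \<xi>) / (4 * pi * \<tau>))" for \<xi>
      proof (cases "\<xi> > 0")
        case True
        then show ?thesis using \<open>\<tau> > 0\<close> by (simp add: abs_mult frac_le)
      qed (simp add: supp)
      then show "AE \<xi> in lborel. norm (1 / (4 * pi * (\<tau> + \<xi>)) * norm (h \<xi>)) \<le> norm (norm (h \<xi>) / (4 * pi * \<tau>))"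
        by simp
    qed measurable
    ultimately show "integrable lborel (\<lambda>\<xi>. \<integral>x. norm ((heat \<tau> x * heat \<xi> x) *\<^sub>R h \<xi>) \<partial>lborel)"
      by simp
  qed
  have inner: "(\<integral>x. (heat \<tau> x * heat \<xi> x) *\<^sub>R h \<xi> \<partial>lborel) = h \<xi> / of_real (4 * pi * (\<tau> + \<xi>))" for \<xi>
  proof (cases "\<xi> > 0")
    case True
    then show ?thesis
      using sg[OF True] unfolding has_bochner_integral_iff
      by (subst integral_scaleR_left) (auto simp: scaleR_conv_of_real)
  qed (simp add: supp)
  have outer: "(\<integral>\<xi>. (heat \<tau> x * heat \<xi> x) *\<^sub>R h \<xi> \<partial>lborel)
      = heat \<tau> x *\<^sub>R (\<integral>\<xi>. heat \<xi> x *\<^sub>R h \<xi> \<partial>lborel)" for x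
    by (simp only: scaleR_scaleR[symmetric] integral_scaleR_right)
  from swap[unfolded inner outer] show ?thesis by simp
qed

section \<open>States and controls in terms of Borel representatives\<close>

lemma state_free_eq:
  assumes "w \<in> borel_measurable borel" "AE z in lborel. W0 z = w z"
  shows "state_free W0 x T = (\<integral>z. heat T (x - z) *\<^sub>R w z \<partial>lborel)"
proof -
  have [measurable]: "w \<in> borel_measurable borel" by fact
  have [measurable]: "(\<lambda>z. heat T (x - z)) \<in> borel_measurable borel"
    unfolding heat_def by measurable
  have hk: "heat_kernel T y = of_real (heat T y)" for y by (simp add: heat_kernel_def heat_def)
  have "state_free W0 x T = (\<integral>z. heat T (x - z) *\<^sub>R W0 z \<partial>lebesgue)"
    by (simp add: state_free_def Defs.convolution_def hk scaleR_conv_of_real)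
  also have "\<dots> = (\<integral>z. heat T (x - z) *\<^sub>R w z \<partial>lebesgue)"
  proof (rule integral_cong_AE)
    show "AE z in lebesgue. heat T (x - z) *\<^sub>R W0 z = heat T (x - z) *\<^sub>R w z"
      using AE_completion[OF assms(2)] by eventually_elim simp
    show hw: "(\<lambda>z. heat T (x - z) *\<^sub>R w z) \<in> borel_measurable lebesgue"
      by (intro measurable_completion) simp
    show "(\<lambda>z. heat T (x - z) *\<^sub>R W0 z) \<in> borel_measurable lebesgue"
      by (rule borel_measurable_AE[OF hw])
        (use AE_completion[OF assms(2)] in eventually_elim, simp)
  qed
  also have "\<dots> = (\<integral>z. heat T (x - z) *\<^sub>R w z \<partial>lborel)"
    by (intro integral_completion) simp
  finally show ?thesis .
qed

text \<open>The bound and the support condition are made to hold everywhere by setting the function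
  to zero where either fails; this changes the control only on a null subset of the
  interval.\<close>

lemma Linf_borel_representative:
  assumes "u \<in> Linf T"
  obtains f C where "f \<in> borel_measurable borel" "\<And>t. norm (f t) \<le> C"
    "\<And>t. t \<notin> {0<..<T} \<Longrightarrow> f t = 0" "AE t in lborel. t \<in> {0<..<T} \<longrightarrow> u t = f t"
proof -
  define u' where "u' = (\<lambda>t. if t \<in> {0<..<T} then u t else 0)"
  from assms have "u \<in> borel_measurable (lebesgue_on {0<..<T})" by (simp add: Linf_def)
  then have "u' \<in> borel_measurable lebesgue"
    unfolding u'_def by (subst borel_measurable_if) auto
  then obtain g where g: "g \<in> borel_measurable borel" "AE t in lborel. u' t = g t"
    by (rule AE_eq_borel_complex)
  from assms obtain C where "AE t in lebesgue_on {0<..<T}. norm (u t) \<le> C" by (auto simp: Linf_def)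
  then have C: "AE t in lborel. t \<in> {0<..<T} \<longrightarrow> norm (u t) \<le> C"
    by (simp add: AE_restrict_space_iff AE_completion_iff)
  define f where "f = (\<lambda>t. if t \<in> {0<..<T} \<and> norm (g t) \<le> C then g t else 0)"
  show thesis
  \<comment> \<open>The value 0 taken outside the interval must obey the bound too, and
    \<open>C\<close> carries no sign.\<close>
  proof (rule that[of f "max C 0"])
    show "f \<in> borel_measurable borel" unfolding f_def using g(1) by measurable
    show "AE t in lborel. t \<in> {0<..<T} \<longrightarrow> u t = f t"
      using g(2) C by eventually_elim (auto simp: f_def u'_def)
  qed (auto simp: f_def)
qed

text \<open>The kernel 1/(2\<xi>) exp(...) is 2 pi times the heat kernel, so the prefactor -1/pi
  becomes -2, the strength of the point source in the equation. Extension of \<open>f\<close> by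
  zero replaces the restriction of the integral to (0,T).\<close>

lemma state_ctrl_eq:
  assumes f: "f \<in> borel_measurable borel" "\<And>t. t \<notin> {0<..<T} \<Longrightarrow> f t = 0"
    and uf: "AE t in lborel. t \<in> {0<..<T} \<longrightarrow> u t = f t"
  shows "state_ctrl u x T = - 2 * (\<integral>\<xi>. heat \<xi> x *\<^sub>R f (T - \<xi>) \<partial>lborel)"
proof -
  have [measurable]: "f \<in> borel_measurable borel" by fact
  define k where "k = (\<lambda>\<xi>::real. complex_of_real (1 / (2 * \<xi>) * exp (- (norm x)\<^sup>2 / (4 * \<xi>))))"
  have [measurable]: "k \<in> borel_measurable borel" unfolding k_def by measurable
  have k_heat: "k \<xi> * c = (2 * pi) *\<^sub>R (heat \<xi> x *\<^sub>R c)" for \<xi> c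
    by (simp add: k_def heat_def scaleR_conv_of_real)
  have "AE \<xi> in lborel. T - \<xi> \<in> {0<..<T} \<longrightarrow> u (T - \<xi>) = f (T - \<xi>)"
    by (rule AE_lborel_reflect[OF uf])
  then have ae: "AE \<xi> in lborel. indicator {0<..<T} \<xi> *\<^sub>R (k \<xi> * u (T - \<xi>)) = k \<xi> * f (T - \<xi>)"
    by eventually_elim (auto simp: indicator_def f(2))
  have "(\<integral>\<xi>. k \<xi> * u (T - \<xi>) \<partial>lebesgue_on {0<..<T})
      = (\<integral>\<xi>. indicator {0<..<T} \<xi> *\<^sub>R (k \<xi> * u (T - \<xi>)) \<partial>lebesgue)"
    by (subst integral_restrict_space) auto
  also have "\<dots> = (\<integral>\<xi>. k \<xi> * f (T - \<xi>) \<partial>lebesgue)"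
  proof (rule integral_cong_AE)
    show kf: "(\<lambda>\<xi>. k \<xi> * f (T - \<xi>)) \<in> borel_measurable lebesgue"
      by (intro measurable_completion) simp
    show "AE \<xi> in lebesgue. indicator {0<..<T} \<xi> *\<^sub>R (k \<xi> * u (T - \<xi>)) = k \<xi> * f (T - \<xi>)"
      by (rule AE_completion[OF ae])
    then show "(\<lambda>\<xi>. indicator {0<..<T} \<xi> *\<^sub>R (k \<xi> * u (T - \<xi>))) \<in> borel_measurable lebesgue"
      by (intro borel_measurable_AE[OF kf]) (auto elim: eventually_mono)
  qed
  also have "\<dots> = (\<integral>\<xi>. k \<xi> * f (T - \<xi>) \<partial>lborel)"
    by (intro integral_completion) simp
  also have "\<dots> = (2 * pi) *\<^sub>R (\<integral>\<xi>. heat \<xi> x *\<^sub>R f (T - \<xi>) \<partial>lborel)"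
    unfolding k_heat by (rule integral_scaleR_right)
  finally show ?thesis
    unfolding state_ctrl_def k_def by (simp add: scaleR_conv_of_real)
qed

section \<open>Vanishing of the control, then of the initial state\<close>

theorem theorem3p15:
  fixes W0 :: "real^2 \<Rightarrow> complex" and T :: real
  assumes "T > 0"
    and "W0 \<in> H0_hat"
    and "controllable_to W0 (\<lambda>x. 0) T"
  shows "AE x in lebesgue. W0 x = 0"
proof -
  from assms(2) have W0: "W0 \<in> borel_measurable lebesgue" "integrable lebesgue (\<lambda>x. (norm (W0 x))\<^sup>2)"
    by (auto simp: H0_hat_def L2_plane_def)
  obtain w where w [measurable]: "w \<in> borel_measurable borel" and W0w: "AE x in lborel. W0 x = w x"
    using AE_eq_borel_complex[OF W0(1)] .
  have "integrable lebesgue (\<lambda>x. (norm (w x))\<^sup>2)"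
  proof (rule integrable_cong_AE_imp[OF W0(2)])
    show "AE x in lebesgue. (norm (W0 x))\<^sup>2 = (norm (w x))\<^sup>2"
      using AE_completion[OF W0w] by eventually_elim simp
  qed (intro measurable_completion; simp)
  then have w2: "integrable lborel (\<lambda>x. (norm (w x))\<^sup>2)"
    by (subst (asm) integrable_completion) auto
  obtain u where u: "u \<in> Linf T" "AE x in lebesgue. 0 = state_free W0 x T + state_ctrl u x T"
    using assms(3) by (auto simp: controllable_to_def)
  obtain f C where f [measurable]: "f \<in> borel_measurable borel" and f_bd: "\<And>t. norm (f t) \<le> C"
    and supp: "\<And>t. t \<notin> {0<..<T} \<Longrightarrow> f t = 0" and uf: "AE t in lborel. t \<in> {0<..<T} \<longrightarrow> u t = f t"
    using Linf_borel_representative[OF u(1)] by metis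
  define Free where "Free = (\<lambda>x. \<integral>z. heat T (x - z) *\<^sub>R w z \<partial>lborel)"
  have balance: "AE x in lborel. Free x = 2 * (\<integral>\<xi>. heat \<xi> x *\<^sub>R f (T - \<xi>) \<partial>lborel)"
  proof -
    have "state_ctrl u x T = - 2 * (\<integral>\<xi>. heat \<xi> x *\<^sub>R f (T - \<xi>) \<partial>lborel)" for x
      by (rule state_ctrl_eq) (fact f supp uf)+
    then show ?thesis
      using u(2) unfolding AE_completion_iff state_free_eq[OF w W0w] by (simp add: Free_def)
  qed
  have free: "(\<integral>x. heat \<tau> (p - x) *\<^sub>R Free x \<partial>lborel) = (\<integral>z. heat (\<tau> + T) (p - z) *\<^sub>R w z \<partial>lborel)"
    if "\<tau> > 0" for \<tau> p
    unfolding Free_def by (rule free_pairing[OF w w2 that assms(1)])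
  have Free_meas [measurable]: "Free \<in> borel_measurable borel"
    unfolding Free_def heat_def by measurable
  have f_int: "integrable lborel f"
  proof (rule Bochner_Integration.integrable_bound)
    show "integrable lborel (\<lambda>t. indicator {0<..<T} t *\<^sub>R C)"
      by (intro integrable_scaleR_left integrable_real_indicator) (auto simp: assms(1) less_imp_le)
    show "AE t in lborel. norm (f t) \<le> norm (indicator {0<..<T} t *\<^sub>R C)"
      using f_bd supp by (intro AE_I2) (auto simp: indicator_def intro: order_trans[OF _ abs_ge_self])
  qed simp
  \<comment> \<open>The factor 1/(2a) makes \<open>A\<close> equal to 2 pi times the pairing of
    \<open>w\<close> with the heat kernel of time \<open>a\<close> at the origin; with it the
    identity with the Stieltjes transform has no constant.\<close>
  define A where "A = (\<lambda>a. 1 / (2 * a) * (\<integral>z. exp (- (1 / (4 * a)) * of_real ((norm (0 - z))\<^sup>2)) * w z \<partial>lborel))"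
  have "AE t in lborel. f t = 0"
  proof (rule stieltjes_transform_inj[OF assms(1) f_int supp])
    have "(\<lambda>a. \<integral>z. exp (- a * of_real ((norm (0 - z))\<^sup>2)) * w z \<partial>lborel) \<circ> (\<lambda>a. 1 / (4 * a)) holomorphic_on {a. Re a > 0}"
    proof (rule holomorphic_on_compose_gen[OF _ holomorphic_on_gauss_transform[OF w w2]])
      show "(\<lambda>a. 1 / (4 * a)) holomorphic_on {a. Re a > 0}"
        by (intro holomorphic_intros) auto
      \<comment> \<open>Inversion preserves the right half-plane, since Re (1/a) = Re a /
        |a|^2.\<close>
      show "(\<lambda>a. 1 / (4 * a)) ` {a. Re a > 0} \<subseteq> {b. Re b > 0}"
        by (auto simp: Re_divide intro!: divide_pos_pos add_pos_nonneg)
    qed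
    then show "A holomorphic_on {a. Re a > 0}"
      unfolding A_def o_def by (intro holomorphic_on_mult holomorphic_intros) auto
    fix a :: real assume a: "a > T"
    define \<tau> where "\<tau> = a - T"
    have \<tau>: "\<tau> > 0" "\<tau> + T = a" using a by (auto simp: \<tau>_def)
    have "(\<integral>z. heat a (0 - z) *\<^sub>R w z \<partial>lborel) = (\<integral>x. heat \<tau> (0 - x) *\<^sub>R Free x \<partial>lborel)"
      using free[OF \<tau>(1), of 0] \<tau>(2) by simp
    also have "\<dots> = (\<integral>x. 2 *\<^sub>R (heat \<tau> x *\<^sub>R (\<integral>\<xi>. heat \<xi> x *\<^sub>R f (T - \<xi>) \<partial>lborel)) \<partial>lborel)"
    proof (rule integral_cong_AE)
      show "AE x in lborel. heat \<tau> (0 - x) *\<^sub>R Free x = 2 *\<^sub>R (heat \<tau> x *\<^sub>R (\<integral>\<xi>. heat \<xi> x *\<^sub>R f (T - \<xi>) \<partial>lborel))"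
        using balance by eventually_elim (simp add: heat_def scaleR_conv_of_real)
      show "(\<lambda>x. heat \<tau> (0 - x) *\<^sub>R Free x) \<in> borel_measurable lborel"
        unfolding heat_def by measurable
      show "(\<lambda>x. 2 *\<^sub>R (heat \<tau> x *\<^sub>R (\<integral>\<xi>. heat \<xi> x *\<^sub>R f (T - \<xi>) \<partial>lborel))) \<in> borel_measurable lborel"
        unfolding heat_def by measurable
    qed
    also have "\<dots> = 2 *\<^sub>R (\<integral>\<xi>. f (T - \<xi>) / of_real (4 * pi * (\<tau> + \<xi>)) \<partial>lborel)"
    proof (subst integral_scaleR_right, subst ctrl_pairing)
      show "integrable lborel (\<lambda>\<xi>. f (T - \<xi>))"
        using lborel_integrable_real_affine[OF f_int, of "-1" T] by simp
    qed (use supp \<tau> in auto)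
    also have "(\<integral>\<xi>. f (T - \<xi>) / of_real (4 * pi * (\<tau> + \<xi>)) \<partial>lborel)
        = (\<integral>t. f t / of_real (4 * pi * (a - t)) \<partial>lborel)"
      \<comment> \<open>The substitution \<open>t = T - \<xi>\<close> gives
        \<open>\<tau> + \<xi> = a - t\<close>.\<close>
      by (subst (2) lborel_integral_real_affine[of "-1" _ T]) (simp_all add: \<tau>_def algebra_simps)
    also have "\<dots> = (\<integral>t. (1 / of_real (4 * pi)) * (f t / (of_real a - of_real t)) \<partial>lborel)"
      by (simp add: mult.assoc)
    also have "\<dots> = (1 / of_real (4 * pi)) * (\<integral>t. f t / (of_real a - of_real t) \<partial>lborel)"
      by (rule integral_mult_right_zero)
    finally have 1: "(\<integral>z. heat a (0 - z) *\<^sub>R w z \<partial>lborel)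
        = 2 *\<^sub>R ((1 / of_real (4 * pi)) * (\<integral>t. f t / (of_real a - of_real t) \<partial>lborel))" .
    have 2: "heat a (0 - z) *\<^sub>R w z = (1 / of_real (4 * pi * a)) *
        (exp (- (1 / (4 * of_real a)) * of_real ((norm (0 - z))\<^sup>2)) * w z)" for z
      by (simp add: heat_def scaleR_conv_of_real exp_of_real[symmetric])
    have "(\<integral>z. heat a (0 - z) *\<^sub>R w z \<partial>lborel) = (1 / of_real (2 * pi)) * A (of_real a)"
      unfolding 2 integral_mult_right_zero by (simp add: A_def)
    then show "A (of_real a) = (\<integral>t. f t / (of_real a - of_real t) \<partial>lborel)"
      using 1 by (simp add: scaleR_conv_of_real)
  qed
  then have "AE \<xi> in lborel. f (T - \<xi>) = 0" by (rule AE_lborel_reflect)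
  then have "(\<integral>\<xi>. heat \<xi> x *\<^sub>R f (T - \<xi>) \<partial>lborel) = 0" for x
    by (intro integral_eq_zero_AE) auto
  with balance have Free0: "AE x in lborel. Free x = 0" by simp
  have "AE z in lborel. w z = 0"
  proof (rule gauss_transform_inj[OF w w2])
    fix b :: real and p :: "real^2" assume b: "b > 0"
    show "(\<integral>z. exp (- b * (norm (p - z))\<^sup>2) *\<^sub>R w z \<partial>lborel) = 0"
    proof (rule gauss_transform_zero_extend[OF w w2, where ?b0.0 = "1 / (4 * T)"])
      fix b assume b: "0 < b" "b < 1 / (4 * T)"
      \<comment> \<open>The rate \<open>b\<close> belongs to time 1/(4b), which exceeds
        \<open>T\<close> exactly when b < 1/(4T); \<tau> is the additional time for which the
        vanishing state at time \<open>T\<close> is evolved.\<close>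
      define \<tau> where "\<tau> = 1 / (4 * b) - T"
      have \<tau>: "\<tau> > 0" "\<tau> + T = 1 / (4 * b)"
        using b assms(1) by (auto simp: \<tau>_def field_simps)
      have "(\<integral>z. heat (1 / (4 * b)) (p - z) *\<^sub>R w z \<partial>lborel) = (\<integral>x. heat \<tau> (p - x) *\<^sub>R Free x \<partial>lborel)"
        using free[OF \<tau>(1), of p] \<tau>(2) by simp
      also have "\<dots> = 0"
        using Free0 by (intro integral_eq_zero_AE) (auto elim: eventually_mono)
      finally have "(\<integral>z. heat (1 / (4 * b)) (p - z) *\<^sub>R w z \<partial>lborel) = 0" .
      moreover have "heat (1 / (4 * b)) (p - z) *\<^sub>R w z = (b / pi) *\<^sub>R (exp (- b * (norm (p - z))\<^sup>2) *\<^sub>R w z)" for z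
        using b by (simp add: heat_def mult_ac)
      ultimately have "(b / pi) *\<^sub>R (\<integral>z. exp (- b * (norm (p - z))\<^sup>2) *\<^sub>R w z \<partial>lborel) = 0"
        by (simp only: integral_scaleR_right)
      then show "(\<integral>z. exp (- b * (norm (p - z))\<^sup>2) *\<^sub>R w z \<partial>lborel) = 0"
        using b by simp
    qed (use b assms(1) in auto)
  qed
  with W0w have "AE z in lborel. W0 z = 0" by eventually_elim simp
  then show ?thesis by (rule AE_completion)
qed

end
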